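(* Let $n$ be a positive integer and write $2n+3=5^{\beta}n_1$ with $n_1$ a positive integer and $5\nmid n_1$. Then $$t(1,1,5,5;n)=\frac 43(5^{\beta+1}-3)\sigma(n_1)-\frac 83c(2n+3).$$
   Context: $\sigma(n)=\sum_{d\mid n,\,d\ge1}d$. The integers $c(n)$ ($n\ge1$) are defined by $q\prod_{k=1}^{\infty}(1-q^{2k})^2(1-q^{10k})^2=\sum_{n=1}^{\infty}c(n)q^n$ for $|q|<1$. For positive integers $a,b,c,d$ and a nonnegative integer $n$, $t(a,b,c,d;n)$ denotes the number of $(x,y,z,w)\in\mathbb Z^4$ with $n=a\frac{x(x-1)}2+b\frac{y(y-1)}2+c\frac{z(z-1)}2+d\frac{w(w-1)}2$. *)

theory Defs
  imports "HOL-Complex_Analysis.Complex_Analysis"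
begin

definition divisor_sum :: "nat \<Rightarrow> nat" where
  "divisor_sum n = (\<Sum>d | d dvd n. d)"

text \<open>Each \<open>x * (x - 1)\<close> is even, so the integer division is exact.\<close>
definition tri_reps :: "nat \<Rightarrow> nat \<Rightarrow> nat \<Rightarrow> nat \<Rightarrow> nat \<Rightarrow> nat" where
  "tri_reps a b c d n = card {(x :: int, y :: int, z :: int, w :: int).
     int n = int a * (x * (x - 1) div 2) + int b * (y * (y - 1) div 2)
           + int c * (z * (z - 1) div 2) + int d * (w * (w - 1) div 2)}"

text \<open>
  The infinite product is taken in the ring of formal power series with its usual topology
  (coefficientwise stabilisation); the factors are indexed from 0. By \<open>eta_coeff_sums\<close> and
  \<open>eta_coeff_unique\<close> below, these are exactly the coefficients in the analytic identity
  for complex \<open>q\<close> with \<open>norm q < 1\<close>.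
\<close>
definition eta_coeff :: "nat \<Rightarrow> int" where
  "eta_coeff n = fps_nth
     (fps_X * (\<Prod>k. (1 - fps_X ^ (2 * Suc k))\<^sup>2 * (1 - fps_X ^ (10 * Suc k))\<^sup>2)) n"

lemma eta_partial_stable:
  fixes P :: "nat \<Rightarrow> int fps"
  defines "P \<equiv> \<lambda>N. \<Prod>k<N. (1 - fps_X ^ (2 * Suc k))\<^sup>2 * (1 - fps_X ^ (10 * Suc k))\<^sup>2"
  assumes "n \<le> N"
  shows "fps_nth (P N) n = fps_nth (P n) n"
  using \<open>n \<le> N\<close>
proof (induction N rule: dec_induct)
  case (step N)
  define x :: "int fps" where "x = fps_X ^ (2 * Suc N)"
  have "fps_X ^ (10 * Suc N) = x ^ 5"
    unfolding x_def power_mult [symmetric] by (simp add: algebra_simps)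
  hence "P (Suc N) = P N * ((1 - x)\<^sup>2 * (1 - x ^ 5)\<^sup>2)"
    by (simp add: P_def x_def)
  also have "\<dots> = P N + x * (P N * (- 2 + x - 2 * x ^ 4 * (1 - x)\<^sup>2 + x ^ 9 * (1 - x)\<^sup>2))"
    by algebra
  finally show ?case
    using step by (simp add: x_def fps_X_power_mult_nth del: power_Suc)
qed auto

lemma eta_coeff_limit:
  "eventually (\<lambda>N. eta_coeff n = fps_nth
     (fps_X * (\<Prod>k<N. (1 - fps_X ^ (2 * Suc k))\<^sup>2 * (1 - fps_X ^ (10 * Suc k))\<^sup>2)) n) sequentially"
proof -
  define f :: "nat \<Rightarrow> int fps" where
    "f = (\<lambda>k. (1 - fps_X ^ (2 * Suc k))\<^sup>2 * (1 - fps_X ^ (10 * Suc k))\<^sup>2)"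
  define L where "L = Abs_fps (\<lambda>n. fps_nth (\<Prod>k<n. f k) n)"
  have stable: "fps_nth (\<Prod>k<N. f k) n = fps_nth L n" if "n \<le> N" for n N
    using eta_partial_stable[OF that] by (simp add: f_def L_def)
  have lim: "(\<lambda>N. \<Prod>k<N. f k) \<longlonglongrightarrow> L"
    by (rule tendsto_fpsI) (use stable in \<open>auto simp: eventually_at_top_linorder\<close>)
  have "fps_nth L 0 = 1"
    by (simp add: L_def)
  hence "L \<noteq> 0" by auto
  hence "f has_prod L"
    using lim by (auto simp: has_prod_def raw_has_prod_def LIMSEQ_lessThan_iff_atMost)
  hence "prodinf f = L"
    by (rule has_prod_unique [symmetric])
  hence *: "eta_coeff n = fps_nth (fps_X * L) n"
    by (simp add: eta_coeff_def f_def)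
  have "eta_coeff n = fps_nth (fps_X * (\<Prod>k<N. f k)) n" if "N \<ge> n" for N
    unfolding * using stable[of "n - 1" N] that by (cases n) auto
  thus ?thesis
    unfolding f_def eventually_at_top_linorder by blast
qed

lemma fps_nth_of_int_prod:
  fixes f :: "nat \<Rightarrow> int fps" and g :: "nat \<Rightarrow> complex fps"
  defines "f \<equiv> \<lambda>k. (1 - fps_X ^ (2 * Suc k))\<^sup>2 * (1 - fps_X ^ (10 * Suc k))\<^sup>2"
  defines "g \<equiv> \<lambda>k. (1 - fps_X ^ (2 * Suc k))\<^sup>2 * (1 - fps_X ^ (10 * Suc k))\<^sup>2"
  shows "fps_nth (fps_X * (\<Prod>k<N. g k)) n = of_int (fps_nth (fps_X * (\<Prod>k<N. f k)) n)"
proof -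
  define R :: "int fps \<Rightarrow> complex fps \<Rightarrow> bool" where
    "R = (\<lambda>F G. \<forall>n. fps_nth G n = of_int (fps_nth F n))"
  have mult: "R (F * F') (G * G')" if "R F G" "R F' G'" for F F' G G'
    using that by (simp add: R_def fps_mult_nth)
  have diff: "R (F - F') (G - G')" if "R F G" "R F' G'" for F F' G G'
    using that by (auto simp: R_def)
  have one: "R 1 1" and X: "R fps_X fps_X"
    by (auto simp: R_def fps_X_def)
  have pow: "R (F ^ m) (G ^ m)" if "R F G" for F G m
    by (induction m) (auto intro: one mult that)
  have "R (f k) (g k)" for k
    unfolding f_def g_def by (intro mult pow diff one X)
  hence "R (\<Prod>k<N. f k) (\<Prod>k<N. g k)"
    by (induction N) (auto intro: one mult)
  hence "R (fps_X * (\<Prod>k<N. f k)) (fps_X * (\<Prod>k<N. g k))"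
    by (intro mult X)
  thus ?thesis
    by (simp add: R_def)
qed

lemma eta_factor_bound:
  fixes q :: complex
  assumes "norm q \<le> r" "r < 1"
  shows "norm ((1 - q ^ (2 * Suc k))\<^sup>2 * (1 - q ^ (10 * Suc k))\<^sup>2 - 1) \<le> 15 * r ^ k"
proof -
  define x where "x = q ^ (2 * Suc k)"
  have r: "0 \<le> r" using assms norm_ge_zero order_trans by blast
  have x5: "q ^ (10 * Suc k) = x ^ 5"
    unfolding x_def power_mult [symmetric] by (simp add: algebra_simps)
  have "norm x = norm q ^ (2 * Suc k)"
    by (simp add: x_def norm_power del: power_Suc)
  also have "\<dots> \<le> r ^ (2 * Suc k)"
    by (intro power_mono assms) auto
  also have "\<dots> \<le> r ^ k"
    using assms r by (intro power_decreasing) auto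
  finally have xr: "norm x \<le> r ^ k" .
  have x1: "norm x \<le> 1"
    using xr r assms by (meson less_imp_le order_trans power_le_one)
  hence p: "norm (x ^ m) \<le> 1" for m
    by (simp add: norm_power power_le_one)
  have "(1 - x)\<^sup>2 * (1 - x ^ 5)\<^sup>2 - 1 =
      x * (- 2 + x + (- 2) * x ^ 4 + 4 * x ^ 5 + (- 2) * x ^ 6 + x ^ 9 + (- 2) * x ^ 10 + x ^ 11)"
    by algebra
  also have "norm \<dots> \<le> norm x * 15"
    unfolding norm_mult
  proof (rule mult_left_mono)
    have "norm (- 2 + x + (- 2) * x ^ 4 + 4 * x ^ 5 + (- 2) * x ^ 6 + x ^ 9 + (- 2) * x ^ 10 + x ^ 11)
       \<le> norm (-2 :: complex) + norm x + norm ((- 2) * x ^ 4) + norm (4 * x ^ 5) + norm ((- 2) * x ^ 6)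
         + norm (x ^ 9) + norm ((- 2) * x ^ 10) + norm (x ^ 11)"
      by (intro norm_triangle_mono order_refl)
    also have "\<dots> \<le> 2 + 1 + 2 * 1 + 4 * 1 + 2 * 1 + 1 + 2 * 1 + 1"
      unfolding norm_mult
      using x1 p[of 4] p[of 5] p[of 6] p[of 9] p[of 10] p[of 11] by simp
    finally show "norm (- 2 + x + (- 2) * x ^ 4 + 4 * x ^ 5 + (- 2) * x ^ 6 + x ^ 9 + (- 2) * x ^ 10 + x ^ 11) \<le> 15"
      by simp
  qed auto
  finally show ?thesis
    using xr by (simp add: x5 x_def [symmetric] del: power_Suc mult_Suc_right)
qed

theorem eta_coeff_sums:
  fixes q :: complex
  assumes "norm q < 1"
  shows "(\<lambda>n. of_int (eta_coeff n) * q ^ n) sums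
    (q * (\<Prod>k. (1 - q ^ (2 * Suc k))\<^sup>2 * (1 - q ^ (10 * Suc k))\<^sup>2))"
proof -
  define h :: "nat \<Rightarrow> complex \<Rightarrow> complex" where
    "h = (\<lambda>k q. (1 - q ^ (2 * Suc k))\<^sup>2 * (1 - q ^ (10 * Suc k))\<^sup>2)"
  obtain r where r: "norm q < r" "r < 1" using dense[OF assms] by blast
  hence r0: "0 < r" using norm_ge_zero le_less_trans by blast
  define A where "A = cball (0::complex) r"
  have summ: "summable (\<lambda>k. 15 * r ^ k)"
    using r r0 by (intro summable_mult summable_geometric) auto
  have bound: "norm (norm (h k z - 1)) \<le> 15 * r ^ k" if "z \<in> A" for k z
    using eta_factor_bound[of z r k] that r by (simp add: A_def h_def del: power_Suc mult_Suc_right)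
  have sumconv: "uniformly_convergent_on A (\<lambda>N x. \<Sum>n<N. norm (h n x - 1))"
    by (rule Weierstrass_m_test [OF bound summ, THEN uniformly_convergentI]) auto
  have conth: "continuous_on B (h k)" for k B
    unfolding h_def by (intro continuous_intros)
  have holh: "(h k) holomorphic_on B" for k B
    unfolding h_def by (intro holomorphic_intros)
  have "uniformly_convergent_on A (\<lambda>N x. \<Prod>n<N. h n x)"
    by (rule uniformly_convergent_on_prod') (use sumconv conth in \<open>auto simp: A_def\<close>)
  then obtain l where l: "uniform_limit A (\<lambda>N x. \<Prod>n<N. h n x) l sequentially"
    by (auto simp: uniformly_convergent_on_def)
  have lprod: "l z = (\<Prod>k. h k z)" if "z \<in> A" for z
  proof -
    have "summable (\<lambda>k. norm (h k z - 1))"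
      by (rule summable_comparison_test' [OF summ]) (use bound that in auto)
    hence "convergent_prod (\<lambda>k. h k z)"
      by (intro abs_convergent_prod_imp_convergent_prod summable_imp_abs_convergent_prod)
    hence "(\<lambda>N. \<Prod>k\<le>N. h k z) \<longlonglongrightarrow> (\<Prod>k. h k z)"
      by (rule convergent_prod_LIMSEQ)
    hence "(\<lambda>N. \<Prod>k<N. h k z) \<longlonglongrightarrow> (\<Prod>k. h k z)"
      by (simp add: LIMSEQ_lessThan_iff_atMost)
    moreover have "(\<lambda>N. \<Prod>k<N. h k z) \<longlonglongrightarrow> l z"
      using l that by (rule tendsto_uniform_limitI)
    ultimately show ?thesis
      by (rule LIMSEQ_unique [symmetric])
  qed
  define PN where "PN = (\<lambda>N z. z * (\<Prod>n<N. h n z))"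
  have bdd: "bounded (l ` A)"
  proof -
    have "continuous_on A l"
      by (rule uniform_limit_theorem [OF _ l]) (auto intro!: always_eventually continuous_intros conth)
    thus ?thesis
      by (intro compact_imp_bounded compact_continuous_image) (auto simp: A_def)
  qed
  have ul: "uniform_limit A PN (\<lambda>z. z * l z) sequentially"
    unfolding PN_def
    by (rule uniform_lim_mult [OF uniform_limit_const l _ bdd]) (auto simp: A_def)
  have holPN: "PN N holomorphic_on B" for N B
    unfolding PN_def by (intro holomorphic_intros holh)
  have holl: "(\<lambda>z. z * l z) holomorphic_on ball 0 r"
    by (rule holomorphic_uniform_limit [where z = 0 and r = r and f = PN and g = "\<lambda>z. z * l z" and F = sequentially])
       (use ul holPN in \<open>auto simp: A_def intro!: always_eventually holomorphic_on_imp_continuous_on\<close>)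
  have expn: "PN N has_fps_expansion
       (fps_X * (\<Prod>k<N. (1 - fps_X ^ (2 * Suc k))\<^sup>2 * (1 - fps_X ^ (10 * Suc k))\<^sup>2))" for N
    unfolding PN_def h_def by (intro fps_expansion_intros)
  have coeff: "(deriv ^^ n) (\<lambda>z. z * l z) 0 = fact n * of_int (eta_coeff n)" for n
  proof -
    have "(\<lambda>N. (deriv ^^ n) (PN N) 0) \<longlonglongrightarrow> (deriv ^^ n) (\<lambda>z. z * l z) 0"
      by (rule higher_deriv_complex_uniform_limit [where A = "ball 0 r"])
         (use uniform_limit_on_subset [OF ul] holPN r0 in \<open>auto simp: A_def\<close>)
    moreover have "eventually (\<lambda>N. (deriv ^^ n) (PN N) 0 = fact n * of_int (eta_coeff n)) sequentially"
      using eta_coeff_limit[of n]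
    proof eventually_elim
      case (elim N)
      show ?case
        using fps_nth_fps_expansion[OF expn, of N n] fps_nth_of_int_prod[of N n] elim
        by (simp add: field_simps del: power_Suc mult_Suc_right)
    qed
    hence "(\<lambda>N. (deriv ^^ n) (PN N) 0) \<longlonglongrightarrow> fact n * of_int (eta_coeff n)"
      by (rule tendsto_eventually)
    ultimately show ?thesis
      by (rule LIMSEQ_unique)
  qed
  have "(\<lambda>n. (deriv ^^ n) (\<lambda>z. z * l z) 0 / fact n * (q - 0) ^ n) sums (q * l q)"
    by (rule holomorphic_power_series [OF holl]) (use r in auto)
  thus ?thesis
    using lprod[of q] r by (simp add: coeff A_def h_def del: power_Suc mult_Suc_right)
qed

theorem eta_coeff_unique:
  fixes b :: "nat \<Rightarrow> int"
  assumes b: "\<And>q :: complex. norm q < 1 \<Longrightarrow> (\<lambda>n. of_int (b (Suc n)) * q ^ Suc n) sums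
    (q * (\<Prod>k. (1 - q ^ (2 * Suc k))\<^sup>2 * (1 - q ^ (10 * Suc k))\<^sup>2))"
  assumes "n \<ge> 1"
  shows "b n = eta_coeff n"
proof (rule ccontr)
  assume ne: "b n \<noteq> eta_coeff n"
  define a where "a = (\<lambda>n. if n = 0 then 0 else complex_of_int (b n - eta_coeff n))"
  have "eta_coeff 0 = 0"
    by (simp add: eta_coeff_def)
  have sums_0: "(\<lambda>n. a n * (q - 0) ^ n) sums 0" if "norm (q - 0) < 1" for q
  proof -
    have q: "norm q < 1" using that by simp
    have "(\<lambda>n. of_int (eta_coeff (Suc n)) * q ^ Suc n) sums
        (q * (\<Prod>k. (1 - q ^ (2 * Suc k))\<^sup>2 * (1 - q ^ (10 * Suc k))\<^sup>2))"
      using eta_coeff_sums[OF q] \<open>eta_coeff 0 = 0\<close>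
      by (subst sums_Suc_iff) (simp del: power_Suc mult_Suc_right)
    from sums_diff[OF b[OF q] this] have "(\<lambda>n. a (Suc n) * q ^ Suc n) sums 0"
      by (simp add: a_def ring_distribs del: power_Suc mult_Suc_right)
    thus ?thesis
      by (subst (asm) sums_Suc_iff) (simp add: a_def)
  qed
  have "a n \<noteq> 0" "0 < n"
    using ne \<open>n \<ge> 1\<close> by (auto simp: a_def)
  then obtain s :: real where s: "0 < s" "\<And>z::complex. z \<in> cball 0 s - {0} \<Longrightarrow> (0::complex) \<noteq> 0"
    using powser_0_nonzero[of 1 0 a "\<lambda>_. 0" n] sums_0 by (metis zero_less_one)
  thus False
    using s(2)[of "of_real s"] by auto
qed

end

theory Submission
  imports Defs
begin

text \<open>
  Let \<open>\<psi>(q)\<close> be the sum of \<open>q^(k(k-1)/2)\<close> over all integers \<open>k\<close>, and put \<open>P = \<psi>(q)^2\<close>,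
  \<open>Q = q \<psi>(q^5)^2\<close>, so that \<open>t(1,1,5,5;n)\<close> is the coefficient of \<open>q^(n+1)\<close> in \<open>P Q\<close>. The theorem
  follows by comparing coefficients in the factorisation
  \<open>P^2 - 6 P Q + 5 Q^2 = (P - Q)(P - 5 Q) = 16 \<Prod> (1 - q^k)^2 (1 - q^(5k))^2\<close> together with
  Legendre's formula \<open>\<psi>(q)^4 = 16 \<Sum> \<sigma>(2n+1) q^n\<close>.

  For the factorisation, split the pairs \<open>(k, l)\<close> counted by \<open>P\<close> by the class of \<open>k + 2l + 1\<close>
  modulo 5. In terms of the Gaussian integer \<open>(2k-1) + (2l-1)i\<close>, class 0 consists of the multiples
  of \<open>2 - i\<close> and contributes \<open>Q\<close>, while multiplication by \<open>i\<close> permutes the other four classes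
  cyclically, so each of them has the same generating function \<open>N\<close>. Thus \<open>P - Q = 4 N\<close> and
  \<open>P - 5 Q = 4 (N - Q)\<close>. A linear substitution turns \<open>N\<close> into a product of two theta series in
  \<open>q^5\<close>, and \<open>N - Q\<close> is, up to a unit, a product of two theta series twisted by a fifth root of
  unity; the Jacobi triple product evaluates both.

  Legendre's formula is equivalent to the differential equation \<open>\<psi> G' = 4 \<psi>' G\<close> for
  \<open>G = \<Sum> \<sigma>(2n+1) q^n\<close>. Its coefficients are sums of a cubic polynomial over the solutions of
  \<open>x^2 + 4 d e = 8n + 5\<close> with \<open>d, e > 0\<close>, which vanish by a Liouville-type involution argument.
\<close>

section \<open>A sum over the solutions of \<open>x\<^sup>2 + 4de = M\<close>\<close>

text \<open>For \<open>M = 8n + 5\<close> this yields the vanishing of the coefficients of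
  \<open>psi G' - 4 psi' G\<close>. The map \<open>tau\<close> exchanges \<open>e > d + x\<close>
  with \<open>e < d + x\<close>; equality would give \<open>M = (x + 2d)^2\<close>, but no square is
  5 modulo 8.\<close>

lemma sum_discriminant_triples_eq_0:
  fixes M :: int
  assumes M: "M mod 8 = 5"
  defines "S \<equiv> {(x, d, e). d > 0 \<and> e > 0 \<and> x\<^sup>2 + 4 * d * e = M}"
  shows "finite S" "(\<Sum>(x, d, e)\<in>S. d\<^sup>2 * e - d * x\<^sup>2) = 0"
proof -
  have bound: "\<bar>x\<bar> \<le> M \<and> d \<le> M \<and> e \<le> M" if "(x, d, e) \<in> S" for x d e
  proof -
    have *: "d > 0" "e > 0" "x\<^sup>2 + 4 * d * e = M" using that by (auto simp: S_def)
    have "d \<le> d * e" "e \<le> d * e" using * by auto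
    moreover have "\<bar>x\<bar> \<le> x\<^sup>2"
      using self_le_power[of "\<bar>x\<bar>" 2] by (cases "x = 0") auto
    moreover have "0 \<le> x\<^sup>2" by simp
    ultimately show ?thesis using * by linarith
  qed
  show fin: "finite S"
  proof (rule finite_subset)
    show "S \<subseteq> {-M..M} \<times> {0..M} \<times> {0..M}"
      using bound by (fastforce simp: S_def)
  qed auto
  define A where "A = {(x, d, e) \<in> S. e > d + x}"
  have nonsquare: "y\<^sup>2 \<noteq> M" for y :: int
  proof
    assume "y\<^sup>2 = M"
    have "y mod 8 \<in> {0..7}" by simp
    hence "y mod 8 \<in> {0,1,2,3,4,5,6,7}" by (simp add: atLeastAtMost_def) presburger
    hence "(y mod 8)\<^sup>2 mod 8 \<noteq> 5" by auto
    thus False using \<open>y\<^sup>2 = M\<close> M by (simp add: power_mod)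
  qed
  have ne: "e \<noteq> d + x" if "(x, d, e) \<in> S" for x d e
  proof
    assume "e = d + x"
    hence "(x + 2 * d)\<^sup>2 = M"
      using that by (simp add: S_def power2_eq_square algebra_simps)
    thus False using nonsquare by blast
  qed
  have A_sub: "A \<subseteq> S" by (auto simp: A_def)
  define tau where "tau = (\<lambda>(x::int, d::int, e::int). (- x, e, d))"
  define rho where "rho = (\<lambda>(x::int, d::int, e::int). (- x - 2 * d, d, e - x - d))"
  have split: "(\<Sum>v\<in>S. f v) = (\<Sum>v\<in>A. f v + f (tau v))" for f :: "int \<times> int \<times> int \<Rightarrow> int"
  proof -
    have "(\<Sum>v\<in>S - A. f v) = (\<Sum>v\<in>A. f (tau v))"
      by (rule sum.reindex_bij_witness[of _ tau tau])
         (use ne in \<open>fastforce simp: tau_def A_def S_def algebra_simps\<close>)+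
    thus ?thesis
      using sum.subset_diff[OF A_sub fin, of f] by (simp add: sum.distrib)
  qed
  \<comment> \<open>\<open>rho\<close> fixes \<open>d\<close>, preserves \<open>x^2 + 4de\<close>
    and turns the conditions \<open>e > 0\<close> and \<open>e > d + x\<close> into each other, so
    it is an involution of \<open>A\<close>.\<close>
  have shift: "(\<Sum>v\<in>A. f (rho v)) = (\<Sum>v\<in>A. f v)" for f :: "int \<times> int \<times> int \<Rightarrow> int"
    by (rule sum.reindex_bij_witness[of _ rho rho])
       (auto simp: rho_def A_def S_def power2_eq_square algebra_simps)
  txt \<open>
    Modulo the odd function \<open>K\<close>, whose sum vanishes, the symmetrisation of \<open>G\<close> under \<open>tau\<close> is half
    the coboundary of \<open>H\<close> with respect to the involution \<open>rho\<close> of \<open>A\<close>; \<open>H\<close> was found by solving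
    for the coefficients of a general cubic.
  \<close>
  define G where "G = (\<lambda>(x::int, d::int, e::int). d\<^sup>2 * e - d * x\<^sup>2)"
  define K where "K = (\<lambda>(x::int, d::int, e::int). x * d\<^sup>2)"
  define H where "H = (\<lambda>(x::int, d::int, e::int). - x * d\<^sup>2 + 2 * x * e\<^sup>2 - 2 * e ^ 3)"
  have "(\<Sum>v\<in>S. K v) = (\<Sum>v\<in>S. - K v)"
    by (rule sum.reindex_bij_witness[of _ "\<lambda>(x, d, e). (- x, d, e)" "\<lambda>(x, d, e). (- x, d, e)"])
       (auto simp: K_def S_def)
  hence K: "(\<Sum>v\<in>S. K v) = 0" by (simp add: sum_negf)
  have *: "2 * ((G v - K v) + (G (tau v) - K (tau v))) = H (rho v) - H v" for v
    by (cases v) (simp add: G_def K_def H_def tau_def rho_def power2_eq_square power3_eq_cube algebra_simps)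
  have "2 * (\<Sum>v\<in>S. G v) = 2 * (\<Sum>v\<in>S. G v - K v)"
    using K by (simp add: sum_subtractf)
  also have "\<dots> = (\<Sum>v\<in>A. 2 * ((G v - K v) + (G (tau v) - K (tau v))))"
    by (subst split) (simp add: sum_distrib_left)
  also have "\<dots> = 0"
    unfolding * using shift[of H] by (simp add: sum_subtractf)
  finally show "(\<Sum>(x, d, e)\<in>S. d\<^sup>2 * e - d * x\<^sup>2) = 0"
    by (simp add: G_def)
qed

section \<open>The Jacobi triple product\<close>

text \<open>Natural-valued, to serve as an exponent; \<open>nat\<close> loses nothing, since a
  product of consecutive integers is never negative. As \<open>k\<close> and \<open>1 - k\<close>
  give the same value, every triangular number occurs exactly twice.\<close>

definition tri :: "int \<Rightarrow> nat" where
  "tri k = nat (k * (k - 1) div 2)"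

lemma mult_pred_nonneg: "0 \<le> k * (k - 1)" for k :: int
  by (cases "k \<ge> 1") (auto intro: mult_nonpos_nonpos)

lemma int_tri: "int (tri k) = k * (k - 1) div 2"
  using mult_pred_nonneg[of k] by (simp add: tri_def)

lemma double_tri: "2 * int (tri k) = k * (k - 1)"
  by (simp add: int_tri)

lemma tri_add_1: "int (tri (k + 1)) = int (tri k) + k"
  using double_tri[of k] double_tri[of "k + 1"] by (simp add: algebra_simps)

lemma tri_diff: "tri (1 - k) = tri k"
  using double_tri[of k] double_tri[of "1 - k"] by (simp add: algebra_simps)

lemma abs_le_tri: "\<bar>k\<bar> \<le> int (tri k) + 1"
proof -
  have "0 \<le> (k - 1) * ((k - 1) - 1)" "0 \<le> (k + 2) * (k + 2 - 1)"
    by (rule mult_pred_nonneg)+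
  thus ?thesis using double_tri[of k] by (simp add: algebra_simps abs_le_iff)
qed

lemma abs_le_tri': "\<bar>k\<bar> \<le> int (tri (k + 1)) + 1"
  using abs_le_tri[of "-k"] tri_diff[of "-k"] by (simp add: algebra_simps)

section \<open>Gaussian binomials and the finite triple product\<close>

definition qpoch :: "'a :: comm_ring_1 \<Rightarrow> nat \<Rightarrow> 'a" where
  "qpoch q n = (\<Prod>i<n. 1 - q ^ Suc i)"

text \<open>The recursion, unlike the usual quotient, makes sense in every commutative ring.
  Truncation in \<open>n - k\<close> is harmless: for \<open>k > n\<close> the power multiplies a
  zero coefficient.\<close>

fun gauss_binomial :: "'a :: comm_ring_1 \<Rightarrow> nat \<Rightarrow> nat \<Rightarrow> 'a" where
  "gauss_binomial q n 0 = 1"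
| "gauss_binomial q 0 (Suc k) = 0"
| "gauss_binomial q (Suc n) (Suc k) =
     gauss_binomial q n (Suc k) + q ^ (n - k) * gauss_binomial q n k"

lemma gauss_binomial_eq_0: "n < k \<Longrightarrow> gauss_binomial q n k = 0"
  by (induction q n k rule: gauss_binomial.induct) auto

text \<open>The dual Pascal rule. In \<open>finite_triple_product\<close> it adds a factor to the
  first product, while the defining rule adds one to the second. Both sides expand to the same
  combination of entries of row \<open>n\<close>.\<close>

lemma gauss_binomial_pascal':
  "gauss_binomial q (Suc n) (Suc k) =
     q ^ Suc k * gauss_binomial q n (Suc k) + gauss_binomial q n k"
proof (induction n arbitrary: k)
  case 0
  show ?case by (cases k) auto
next
  case (Suc n)
  show ?case
  proof (cases "k \<le> Suc n")
    case False
    thus ?thesis by (simp add: gauss_binomial_eq_0)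
  next
    case k: True
    show ?thesis
    proof (cases k)
      case 0
      define G where "G = gauss_binomial q (Suc n) (Suc 0)"
      have "G = q * gauss_binomial q n (Suc 0) + 1" "G = gauss_binomial q n (Suc 0) + q ^ n"
        using Suc[of 0] by (simp_all add: G_def)
      moreover from this(2) have "q * G = q * gauss_binomial q n (Suc 0) + q * q ^ n"
        by (simp only: distrib_left)
      ultimately have "G + q * q ^ n = q * G + 1"
        by (simp only: add_ac)
      thus ?thesis
        unfolding 0 gauss_binomial.simps(3)[of q "Suc n"] by (simp add: G_def)
    next
      case (Suc k')
      define g where "g = gauss_binomial q n"
      have e: "n - k' + Suc k' = Suc n" "Suc n - Suc k' = n - k'" using k Suc by auto
      have p1: "gauss_binomial q (Suc n) (Suc k') = q ^ Suc k' * g (Suc k') + g k'"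
        and p2: "gauss_binomial q (Suc n) (Suc k') = g (Suc k') + q ^ (n - k') * g k'"
        using Suc.IH[of k'] by (simp_all add: g_def)
      have p3: "gauss_binomial q (Suc n) (Suc (Suc k')) = q ^ Suc (Suc k') * g (Suc (Suc k')) + g (Suc k')"
        using Suc.IH[of "Suc k'"] by (simp add: g_def)
      have p4: "q ^ Suc (Suc k') * gauss_binomial q (Suc n) (Suc (Suc k')) =
          q ^ Suc (Suc k') * g (Suc (Suc k')) + q ^ Suc n * g (Suc k')"
      \<comment> \<open>For \<open>n = k'\<close> the truncated \<open>n - Suc k'\<close> is 0
        instead of -1, so the exponents do not add up; there every coefficient involved
        vanishes.\<close>
      proof (cases "n = k'")
        case True
        thus ?thesis by (simp add: g_def gauss_binomial_eq_0)
      next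
        case False
        hence "Suc (Suc k') + (n - Suc k') = Suc n"
          using k Suc by simp
        hence "q ^ Suc (Suc k') * q ^ (n - Suc k') = q ^ Suc n"
          by (metis power_add)
        thus ?thesis by (simp add: g_def algebra_simps)
      qed
      have "q ^ (n - k') * gauss_binomial q (Suc n) (Suc k') =
          q ^ (n - k') * q ^ Suc k' * g (Suc k') + q ^ (n - k') * g k'"
        unfolding p1 by (simp only: distrib_left mult.assoc)
      also have "q ^ (n - k') * q ^ Suc k' = q ^ Suc n"
        using e by (metis power_add)
      finally have p5: "q ^ (n - k') * gauss_binomial q (Suc n) (Suc k') =
          q ^ Suc n * g (Suc k') + q ^ (n - k') * g k'" .
      show ?thesis
        unfolding Suc gauss_binomial.simps(3)[of q "Suc n"] e p5 p4
        unfolding p3 p2 by (simp only: add_ac)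
    qed
  qed
qed

text \<open>The quotient formula, stated without division because \<open>qpoch\<close> need not be
  invertible.\<close>

lemma gauss_binomial_qpoch:
  assumes "k \<le> n"
  shows "gauss_binomial q n k * (qpoch q k * qpoch q (n - k)) = qpoch q n"
  using assms
proof (induction n arbitrary: k)
  case 0
  thus ?case by (simp add: qpoch_def)
next
  case (Suc n)
  show ?case
  proof (cases k)
    case 0
    thus ?thesis by (simp add: qpoch_def)
  next
    case (Suc k')
    show ?thesis
    proof (cases "k' = n")
      case True
      have "gauss_binomial q n n * qpoch q n = qpoch q n"
        using Suc.IH[of n] by (simp add: qpoch_def)
      thus ?thesis using Suc True
        by (simp add: gauss_binomial_eq_0 qpoch_def flip: mult.assoc)
    next
      case False
      hence k': "Suc k' \<le> n" using Suc Suc.prems by simp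
      hence e: "n - k' = Suc (n - Suc k')" by simp
      have "q ^ (n - k') * q ^ Suc k' = q ^ Suc n"
        using k' by (simp flip: power_add power_Suc)
      \<comment> \<open>The induction step with powers abstracted, \<open>Q = q^(n-k')\<close> and
        \<open>R = q^(k'+1)\<close>; it rests on
        \<open>(1 - Q) + Q (1 - R) = 1 - Q R\<close>.\<close>
      moreover have "(g1 + Q * g2) * ((A * (1 - R)) * (B * (1 - Q))) = U * (1 - Q * R)"
        if "g1 * (A * (1 - R) * B) = U" "g2 * (A * (B * (1 - Q))) = U" for g1 g2 A B Q R U :: 'a
      proof -
        have "(g1 + Q * g2) * ((A * (1 - R)) * (B * (1 - Q))) =
            g1 * (A * (1 - R) * B) * (1 - Q) + g2 * (A * (B * (1 - Q))) * (Q * (1 - R))"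
          by (simp add: algebra_simps)
        thus ?thesis unfolding that by (simp add: algebra_simps)
      qed
      moreover have "qpoch q (n - k') = qpoch q (n - Suc k') * (1 - q ^ (n - k'))"
        unfolding e by (simp add: qpoch_def)
      moreover have "qpoch q (Suc k') = qpoch q k' * (1 - q ^ Suc k')"
         "qpoch q (Suc n) = qpoch q n * (1 - q ^ Suc n)"
        by (simp_all add: qpoch_def)
      ultimately show ?thesis
        unfolding Suc gauss_binomial.simps diff_Suc_Suc
        using Suc.IH[of "Suc k'"] Suc.IH[of k'] k' by (metis Suc_leD)
    qed
  qed
qed

lemma sum_gauss_binomial_Suc:
  "(\<Sum>j\<le>Suc n. gauss_binomial q (Suc n) j * f j) =
     (\<Sum>j\<le>n. gauss_binomial q n j * f j) + (\<Sum>j\<le>n. gauss_binomial q n j * (q ^ (n - j) * f (Suc j)))"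
proof -
  have "(\<Sum>j\<le>n. gauss_binomial q n j * f j) = (\<Sum>j\<le>Suc n. gauss_binomial q n j * f j)"
    by (simp add: gauss_binomial_eq_0)
  thus ?thesis
    by (simp only: sum.atMost_Suc_shift gauss_binomial.simps)
       (simp add: algebra_simps sum.distrib)
qed

lemma sum_gauss_binomial_Suc':
  "(\<Sum>j\<le>Suc n. gauss_binomial q (Suc n) j * f j) =
     (\<Sum>j\<le>n. gauss_binomial q n j * (q ^ j * f j)) + (\<Sum>j\<le>n. gauss_binomial q n j * f (Suc j))"
proof -
  have "(\<Sum>j\<le>n. gauss_binomial q n j * (q ^ j * f j)) = (\<Sum>j\<le>Suc n. gauss_binomial q n j * (q ^ j * f j))"
    by (simp add: gauss_binomial_eq_0)
  thus ?thesis
    by (simp only: sum.atMost_Suc_shift gauss_binomial_pascal')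
       (simp add: algebra_simps sum.distrib)
qed

text \<open>A finite form of the Jacobi triple product with base \<open>q = a * b\<close>. All
  exponents are natural numbers, so neither \<open>a\<close> nor \<open>b\<close> has to be
  invertible. Each new factor comes from one of the two Pascal rules.\<close>

theorem finite_triple_product:
  fixes a b :: "'a :: comm_ring_1"
  shows "(\<Prod>i<n. 1 + a ^ i * b ^ Suc i) * (\<Prod>i<m. 1 + a ^ Suc i * b ^ i) =
    (\<Sum>j\<le>n + m. gauss_binomial (a * b) (n + m) j *
       (a ^ tri (int j - int n + 1) * b ^ tri (int j - int n)))"
proof (induction m)
  case 0
  show ?case
  proof (induction n)
    case 0
    show ?case by (simp add: tri_def)
  next
    case (Suc n)
    define f where "f = (\<lambda>n j. a ^ tri (int j - int n + 1) * b ^ tri (int j - int n))"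
    have f1: "f (Suc n) (Suc j) = f n j" for j
      by (simp add: f_def algebra_simps)
    \<comment> \<open>By \<open>tri (k + 1) = tri k + k\<close>, the power from the dual rule
      absorbs the shift from \<open>n\<close> to \<open>Suc n\<close>, leaving the monomial of the
      new factor.\<close>
    have f2: "(a * b) ^ j * f (Suc n) j = a ^ n * b ^ Suc n * f n j" for j
    proof -
      have "j + tri (int j - int (Suc n) + 1) = n + tri (int j - int n + 1)"
        "j + tri (int j - int (Suc n)) = Suc n + tri (int j - int n)"
        using tri_add_1[of "int j - int n"] tri_add_1[of "int j - int n - 1"]
        by (auto simp: algebra_simps)
      hence "a ^ (j + tri (int j - int (Suc n) + 1)) * b ^ (j + tri (int j - int (Suc n))) =
             a ^ (n + tri (int j - int n + 1)) * b ^ (Suc n + tri (int j - int n))"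
        by (simp only:)
      thus ?thesis by (simp only: f_def power_add power_mult_distrib mult_ac)
    qed
    have "(\<Sum>j\<le>Suc n. gauss_binomial (a * b) (Suc n) j * f (Suc n) j) =
        (\<Sum>j\<le>n. gauss_binomial (a * b) n j * (a ^ n * b ^ Suc n * f n j))
        + (\<Sum>j\<le>n. gauss_binomial (a * b) n j * f n j)"
      by (simp only: sum_gauss_binomial_Suc' f1 f2)
    also have "\<dots> = (1 + a ^ n * b ^ Suc n) * (\<Sum>j\<le>n. gauss_binomial (a * b) n j * f n j)"
      by (simp only: distrib_right mult_1_left) (simp only: sum_distrib_left mult_ac add_ac)
    also have "\<dots> = (\<Prod>i<Suc n. 1 + a ^ i * b ^ Suc i)"
      using Suc by (simp add: f_def mult.commute)
    finally show ?case by (simp add: f_def)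
  qed
next
  case (Suc m)
  define f where "f = (\<lambda>j. a ^ tri (int j - int n + 1) * b ^ tri (int j - int n))"
  have f2: "(a * b) ^ (n + m - j) * f (Suc j) = a ^ Suc m * b ^ m * f j" if "j \<le> n + m" for j
  proof -
    have "n + m - j + tri (int (Suc j) - int n + 1) = Suc m + tri (int j - int n + 1)"
      "n + m - j + tri (int (Suc j) - int n) = m + tri (int j - int n)"
      using tri_add_1[of "int j - int n"] tri_add_1[of "int j - int n + 1"] that
      by (auto simp: algebra_simps)
    hence "a ^ (n + m - j + tri (int (Suc j) - int n + 1)) * b ^ (n + m - j + tri (int (Suc j) - int n)) =
           a ^ (Suc m + tri (int j - int n + 1)) * b ^ (m + tri (int j - int n))"
      by (simp only:)
    thus ?thesis by (simp only: f_def power_add power_mult_distrib mult_ac)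
  qed
  have "(\<Sum>j\<le>Suc (n + m). gauss_binomial (a * b) (Suc (n + m)) j * f j) =
      (\<Sum>j\<le>n + m. gauss_binomial (a * b) (n + m) j * f j)
      + (\<Sum>j\<le>n + m. gauss_binomial (a * b) (n + m) j * (a ^ Suc m * b ^ m * f j))"
    unfolding sum_gauss_binomial_Suc by (intro arg_cong2[of _ _ _ _ "(+)"] sum.cong refl) (simp only: f2 atMost_iff)
  also have "\<dots> = (1 + a ^ Suc m * b ^ m) * (\<Sum>j\<le>n + m. gauss_binomial (a * b) (n + m) j * f j)"
    by (simp only: distrib_right mult_1_left) (simp only: sum_distrib_left mult_ac add_ac)
  also have "\<dots> = (\<Prod>i<n. 1 + a ^ i * b ^ Suc i) * (\<Prod>i<Suc m. 1 + a ^ Suc i * b ^ i)"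
    using Suc by (simp add: f_def mult_ac)
  finally show ?case by (simp add: f_def)
qed

section \<open>Generating functions of weighted families\<close>

text \<open>Over an infinite fibre the sum takes the default value 0; \<open>finite_fibres\<close>
  excludes this.\<close>

definition gen_fps :: "('i \<Rightarrow> nat) \<Rightarrow> ('i \<Rightarrow> 'a) \<Rightarrow> 'a :: comm_ring_1 fps" where
  "gen_fps e w = Abs_fps (\<lambda>n. \<Sum>k | e k = n. w k)"

definition finite_fibres :: "('i \<Rightarrow> nat) \<Rightarrow> bool" where
  "finite_fibres e \<longleftrightarrow> (\<forall>n. finite {k. e k = n})"

lemma finite_fibresD: "finite_fibres e \<Longrightarrow> finite {k. e k = n}"
  by (simp add: finite_fibres_def)

lemma finite_fibres_add:
  assumes "finite_fibres e" "finite_fibres f"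
  shows "finite_fibres (\<lambda>(k, l). e k + f l)"
  unfolding finite_fibres_def
proof
  fix n
  have "{(k, l). e k + f l = n} \<subseteq> (\<Union>i\<le>n. {k. e k = i}) \<times> (\<Union>i\<le>n. {l. f l = i})"
    by auto
  moreover have "finite \<dots>"
    using assms by (auto simp: finite_fibres_def)
  ultimately show "finite {kl. (case kl of (k, l) \<Rightarrow> e k + f l) = n}"
    using finite_subset by (simp add: case_prod_unfold)
qed

lemma gen_fps_mult:
  assumes "finite_fibres e" "finite_fibres f"
  shows "gen_fps e v * gen_fps f w = gen_fps (\<lambda>(k, l). e k + f l) (\<lambda>(k, l). v k * w l)"
proof (rule fps_ext)
  fix n
  define S where "S = {(k, l). e k + f l = n}"
  have fin: "finite S"
    using finite_fibresD[OF finite_fibres_add[OF assms], of n] by (simp add: S_def case_prod_unfold)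
  have "fps_nth (gen_fps e v * gen_fps f w) n =
      (\<Sum>i\<in>{0..n}. \<Sum>(k, l)\<in>{k. e k = i} \<times> {l. f l = n - i}. v k * w l)"
    by (simp add: fps_mult_nth gen_fps_def sum_product sum.cartesian_product)
  also have "\<dots> = (\<Sum>i\<in>{0..n}. \<Sum>(k, l)\<in>{p \<in> S. e (fst p) = i}. v k * w l)"
    by (intro sum.cong refl) (auto simp: S_def)
  also have "\<dots> = (\<Sum>(k, l)\<in>S. v k * w l)"
    by (rule sum.group) (use fin in \<open>auto simp: S_def\<close>)
  finally show "fps_nth (gen_fps e v * gen_fps f w) n =
      fps_nth (gen_fps (\<lambda>(k, l). e k + f l) (\<lambda>(k, l). v k * w l)) n"
    by (simp add: gen_fps_def S_def case_prod_unfold)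
qed

section \<open>Truncated series and the infinite triple product\<close>

text \<open>Congruence modulo \<open>X^(N+1)\<close>. It lets finite products with enough factors
  stand in for infinite ones.\<close>

definition fps_agree :: "nat \<Rightarrow> 'a :: comm_ring_1 fps \<Rightarrow> 'a fps \<Rightarrow> bool" where
  "fps_agree N f g \<longleftrightarrow> (\<forall>n\<le>N. fps_nth f n = fps_nth g n)"

lemma fps_agree_refl [simp]: "fps_agree N f f"
  and fps_agree_sym: "fps_agree N f g \<Longrightarrow> fps_agree N g f"
  and fps_agree_trans [trans]: "fps_agree N f g \<Longrightarrow> fps_agree N g h \<Longrightarrow> fps_agree N f h"
  by (simp_all add: fps_agree_def)

lemma fps_agree_mult:
  "fps_agree N f g \<Longrightarrow> fps_agree N f' g' \<Longrightarrow> fps_agree N (f * f') (g * g')"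
  by (auto simp: fps_agree_def fps_mult_nth intro!: sum.cong)

lemma fps_agree_prod_tail:
  assumes "N \<le> n" "n \<le> m" and f: "\<And>i. i \<ge> N \<Longrightarrow> fps_agree N (f i) 1"
  shows "fps_agree N (\<Prod>i<n. f i) (\<Prod>i<m. f i)"
  using \<open>n \<le> m\<close>
proof (induction m rule: dec_induct)
  case (step m)
  thus ?case
    using fps_agree_mult[OF step.IH fps_agree_sym[OF f[of m]]] \<open>N \<le> n\<close> by (simp add: mult.commute)
qed auto

lemma fps_agree_one_plus:
  fixes c :: "'a :: comm_ring_1"
  shows "N < m \<Longrightarrow> fps_agree N (1 + fps_const c * fps_X ^ m) 1"
    and "N < m \<Longrightarrow> fps_agree N (1 - fps_X ^ m) (1 :: 'a fps)"
    and "N < m \<Longrightarrow> fps_agree N (1 + fps_X ^ m) (1 :: 'a fps)"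
  by (auto simp: fps_agree_def fps_X_power_iff)

text \<open>
  This is Ramanujan's \<open>f(a, b) = \<Sum> a^(k(k+1)/2) b^(k(k-1)/2)\<close> at \<open>a = c X^r\<close>, \<open>b = c^(-1) X^s\<close>.
\<close>
definition ramanujan_theta :: "'a :: field \<Rightarrow> nat \<Rightarrow> nat \<Rightarrow> 'a fps" where
  "ramanujan_theta c r s = gen_fps (\<lambda>k. r * tri (k + 1) + s * tri k) (\<lambda>k. c powi k)"

lemma abs_le_theta_exponent:
  assumes "r + s > 0"
  shows "\<bar>k\<bar> \<le> int (r * tri (k + 1) + s * tri k) + 1"
proof (cases "r = 0")
  case True
  hence "tri k \<le> r * tri (k + 1) + s * tri k" using assms by auto
  thus ?thesis using abs_le_tri[of k] by linarith
next
  case False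
  hence "tri (k + 1) \<le> r * tri (k + 1) + s * tri k" by (auto intro: trans_le_add1)
  thus ?thesis using abs_le_tri'[of k] by linarith
qed

lemma finite_fibres_theta:
  assumes "r + s > 0"
  shows "finite_fibres (\<lambda>k. r * tri (k + 1) + s * tri k)"
  unfolding finite_fibres_def
proof
  fix n
  have "{k. r * tri (k + 1) + s * tri k = n} \<subseteq> {- int n - 1..int n + 1}"
  proof
    fix k assume "k \<in> {k. r * tri (k + 1) + s * tri k = n}"
    thus "k \<in> {- int n - 1..int n + 1}"
      using abs_le_theta_exponent[OF assms, of k] by (auto simp: abs_le_iff)
  qed
  thus "finite {k. r * tri (k + 1) + s * tri k = n}"
    using finite_subset by blast
qed

lemma power_tri_powi:
  fixes c :: "'a :: field"
  assumes "c \<noteq> 0"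
  shows "c ^ tri (k + 1) * inverse c ^ tri k = c powi k"
proof -
  have "c ^ tri (k + 1) * inverse c ^ tri k = c powi (int (tri (k + 1)) - int (tri k))"
    using assms by (simp add: power_int_diff field_simps)
  thus ?thesis by (simp add: tri_add_1)
qed

text \<open>Up to degree \<open>N\<close>, every \<open>qpoch q i\<close> with \<open>i >= N\<close>
  equals the same invertible series \<open>E\<close>. The quotient formula becomes
  \<open>G E E = E\<close>, hence \<open>E G = 1\<close>.\<close>

lemma qpoch_gauss_binomial_agree:
  fixes q :: "'a :: field fps"
  assumes m: "m > 0" and q: "q = fps_X ^ m" and "N \<le> l" "N \<le> k" "k + N \<le> n"
  shows "fps_agree N (qpoch q l * gauss_binomial q n k) 1"
proof -
  define E where "E = qpoch q N"
  have E: "fps_agree N (qpoch q i) E" if "N \<le> i" for i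
    unfolding E_def qpoch_def
  proof (rule fps_agree_sym, rule fps_agree_prod_tail)
    fix j assume "N \<le> j"
    have "q ^ Suc j = fps_X ^ (m * Suc j)" unfolding q by (simp only: power_mult)
    moreover have "N < m * Suc j" using \<open>N \<le> j\<close> m by (cases m) auto
    ultimately show "fps_agree N (1 - q ^ Suc j) 1" using fps_agree_one_plus(2) by metis
  qed (use that in auto)
  have "fps_nth (1 - q ^ Suc j) 0 = 1" for j
    using m by (simp add: q fps_X_power_iff flip: power_mult power_Suc)
  hence "fps_nth E 0 = 1" unfolding E_def qpoch_def by (induction N) auto
  hence inv: "E * inverse E = 1" by (simp add: inverse_mult_eq_1' )
  define G where "G = gauss_binomial q n k"
  have "G * (qpoch q k * qpoch q (n - k)) = qpoch q n"
    unfolding G_def by (rule gauss_binomial_qpoch) (use assms in auto)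
  moreover have "fps_agree N (G * (qpoch q k * qpoch q (n - k))) (G * (E * E))"
    using assms by (intro fps_agree_mult E fps_agree_refl) auto
  ultimately have "fps_agree N (G * (E * E)) E"
    using E[of n] assms by (metis fps_agree_sym fps_agree_trans add_leE)
  hence "fps_agree N (G * (E * E) * inverse E) (E * inverse E)"
    by (intro fps_agree_mult fps_agree_refl)
  moreover have "G * (E * E) * inverse E = E * G" using inv by (simp add: algebra_simps)
  ultimately have "fps_agree N (E * G) 1" using inv by simp
  moreover have "fps_agree N (qpoch q l * G) (E * G)"
    using assms by (intro fps_agree_mult E fps_agree_refl)
  ultimately show ?thesis unfolding G_def by (rule fps_agree_trans[rotated])
qed

text \<open>Multiplying the finite product by \<open>qpoch q l\<close> turns each relevant binomial
  into 1. The three lengths are independent so that a product with a constant first factor may be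
  one factor longer.\<close>

theorem triple_product_agree:
  fixes c :: "'a :: field" and r s :: nat
  defines "a \<equiv> fps_const c * fps_X ^ r" and "b \<equiv> fps_const (inverse c) * fps_X ^ s"
  assumes c: "c \<noteq> 0" and rs: "r + s > 0"
    and bounds: "2 * N + 1 \<le> l" "2 * N + 1 \<le> n" "2 * N + 1 \<le> m"
  shows "fps_agree N (ramanujan_theta c r s)
    ((\<Prod>i<l. 1 - fps_X ^ ((r + s) * Suc i)) *
     ((\<Prod>i<n. 1 + a ^ i * b ^ Suc i) * (\<Prod>i<m. 1 + a ^ Suc i * b ^ i)))"
  unfolding fps_agree_def
proof (intro allI impI)
  fix p assume p: "p \<le> N"
  define e where "e = (\<lambda>k. r * tri (k + 1) + s * tri k)"
  define q :: "'a fps" where "q = fps_X ^ (r + s)"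
  have ab: "a * b = q"
    using c by (simp add: a_def b_def q_def power_add mult_ac flip: fps_const_mult)
  have qp: "(\<Prod>i<l. 1 - fps_X ^ ((r + s) * Suc i)) = qpoch q l"
    by (simp only: qpoch_def q_def power_mult)
  have mono: "a ^ tri (k + 1) * b ^ tri k = fps_const (c powi k) * fps_X ^ e k" for k
  proof -
    have "a ^ tri (k + 1) * b ^ tri k =
        fps_const (c ^ tri (k + 1) * inverse c ^ tri k) * fps_X ^ e k"
      by (simp add: a_def b_def e_def power_mult_distrib power_add power_mult mult_ac
            fps_const_power flip: fps_const_mult)
    thus ?thesis using c by (simp add: power_tri_powi)
  qed
  have coeff: "fps_nth (qpoch q l * (gauss_binomial q (n + m) j *
        (fps_const (c powi k) * fps_X ^ e k))) p = (if e k = p then c powi k else 0)"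
    if j: "j \<le> n + m" "k = int j - int n" for j k
  proof (cases "e k \<le> p")
    case False
    have eq: "qpoch q l * (gauss_binomial q (n + m) j * (fps_const (c powi k) * fps_X ^ e k)) =
        (qpoch q l * gauss_binomial q (n + m) j * fps_const (c powi k)) * fps_X ^ e k"
      by (simp only: mult_ac)
    show ?thesis using False unfolding eq fps_X_power_mult_right_nth by auto
  next
    case True
    \<comment> \<open>Only such \<open>k\<close> reach degree \<open>N\<close>. With
      \<open>j = k + n\<close>, lengths of at least \<open>2N + 1\<close> then keep \<open>j\<close>
      at distance at least \<open>N\<close> from both ends of the row.\<close>
    have "\<bar>k\<bar> \<le> int N + 1"
      using abs_le_theta_exponent[OF rs, of k] True p unfolding e_def by linarith
    hence "N \<le> j" "j + N \<le> n + m" using j bounds by linarith+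
    hence "fps_agree N (qpoch q l * gauss_binomial q (n + m) j) 1"
      using rs bounds by (intro qpoch_gauss_binomial_agree[of "r + s"]) (auto simp: q_def)
    hence "fps_nth (qpoch q l * gauss_binomial q (n + m) j) (p - e k) = fps_nth 1 (p - e k)"
      using p unfolding fps_agree_def by simp
    moreover have eq: "qpoch q l * (gauss_binomial q (n + m) j * (fps_const (c powi k) * fps_X ^ e k)) =
        fps_const (c powi k) * (qpoch q l * gauss_binomial q (n + m) j) * fps_X ^ e k"
      by (simp only: mult_ac)
    ultimately show ?thesis
      using True unfolding eq fps_X_power_mult_right_nth by auto
  qed
  have "fps_nth ((\<Prod>i<l. 1 - fps_X ^ ((r + s) * Suc i)) *
     ((\<Prod>i<n. 1 + a ^ i * b ^ Suc i) * (\<Prod>i<m. 1 + a ^ Suc i * b ^ i))) p =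
     (\<Sum>j\<le>n + m. fps_nth (qpoch q l * (gauss_binomial q (n + m) j *
        (fps_const (c powi (int j - int n)) * fps_X ^ e (int j - int n)))) p)"
    unfolding qp finite_triple_product ab mono sum_distrib_left fps_sum_nth ..
  also have "\<dots> = (\<Sum>j\<le>n + m. if e (int j - int n) = p then c powi (int j - int n) else 0)"
    by (intro sum.cong refl coeff) auto
  also have "\<dots> = (\<Sum>j\<in>{j \<in> {..n + m}. e (int j - int n) = p}. c powi (int j - int n))"
    by (rule sum.inter_filter [symmetric]) simp
  also have "\<dots> = (\<Sum>k | e k = p. c powi k)"
  proof (rule sum.reindex_bij_witness[of _ "\<lambda>k. nat (k + int n)" "\<lambda>j. int j - int n"])
    fix k assume "k \<in> {k. e k = p}"
    hence "\<bar>k\<bar> \<le> int N + 1"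
      using abs_le_theta_exponent[OF rs, of k] p by (simp add: e_def)
    hence "- int n \<le> k" "k \<le> int m" using bounds by linarith+
    thus "int (nat (k + int n)) - int n = k" "nat (k + int n) \<in> {j \<in> {..n + m}. e (int j - int n) = p}"
      using \<open>k \<in> {k. e k = p}\<close> by auto
  qed auto
  finally show "fps_nth (ramanujan_theta c r s) p =
     fps_nth ((\<Prod>i<l. 1 - fps_X ^ ((r + s) * Suc i)) *
     ((\<Prod>i<n. 1 + a ^ i * b ^ Suc i) * (\<Prod>i<m. 1 + a ^ Suc i * b ^ i))) p"
    by (simp add: ramanujan_theta_def gen_fps_def e_def)
qed

section \<open>Sums of four triangular numbers\<close>

lemma finite_fibres_tri: "finite_fibres tri"
  using finite_fibres_theta[of 0 1] by simp

text \<open>Put \<open>x = 2k - 1\<close> and \<open>d e = 2(n - i) + 1\<close> with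
  \<open>i = tri k\<close>. Then \<open>x^2 = 8i + 1\<close>, so \<open>x^2 + 4de = 8n + 5\<close>,
  and \<open>d^2 e - d x^2 = d (de - x^2) = 2 (n - 5i) d\<close>.\<close>

lemma sum_tri_divisor_sum_eq_0:
  "(\<Sum>i=0..n. int (card {k. tri k = i}) * ((int n - 5 * int i) * int (divisor_sum (2 * (n - i) + 1)))) = 0"
proof -
  define M :: int where "M = 8 * int n + 5"
  define S where "S = {(x, d, e). d > 0 \<and> e > 0 \<and> x\<^sup>2 + 4 * d * e = M}"
  define T where "T = (SIGMA i:{0..n}. {k. tri k = i} \<times> {d. d dvd 2 * (n - i) + 1})"
  have "M mod 8 = 5" unfolding M_def by presburger
  hence S0: "(\<Sum>(x, d, e)\<in>S. d\<^sup>2 * e - d * x\<^sup>2) = 0"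
    unfolding S_def by (rule sum_discriminant_triples_eq_0)
  have sq: "(2 * k - 1)\<^sup>2 = 8 * int (tri k) + 1" for k
    using double_tri[of k] by (simp add: power2_eq_square algebra_simps)
  have key: "int d * int ((2 * (n - i) + 1) div d) = 2 * (int n - int i) + 1"
    if "i \<le> n" "d dvd 2 * (n - i) + 1" for i d
  proof -
    have "d * ((2 * (n - i) + 1) div d) = 2 * (n - i) + 1" using that(2) by simp
    thus ?thesis using that(1) by (metis of_nat_mult of_nat_add of_nat_diff of_nat_numeral of_nat_1)
  qed
  have "(\<Sum>(x, d, e)\<in>S. d\<^sup>2 * e - d * x\<^sup>2) = (\<Sum>(i, k, d)\<in>T. 2 * ((int n - 5 * int i) * int d))"
  proof (rule sym, rule sum.reindex_bij_witness[of _
        "\<lambda>(x, d, e). (tri ((x + 1) div 2), (x + 1) div 2, nat d)"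
        "\<lambda>(i, k, d). (2 * k - 1, int d, int ((2 * (n - i) + 1) div d))"])
    fix t assume t: "t \<in> T"
    obtain i k d where ikd: "t = (i, k, d)" by (cases t)
    define e where "e = (2 * (n - i) + 1) div d"
    have *: "i \<le> n" "tri k = i" "d dvd 2 * (n - i) + 1" using t by (auto simp: T_def ikd)
    have de: "int d * int e = 2 * (int n - int i) + 1" unfolding e_def using * by (intro key)
    have "d > 0" "e > 0" using de *(1) by (auto intro!: Nat.gr0I)
    show "(case case t of (i, k, d) \<Rightarrow> (2 * k - 1, int d, int ((2 * (n - i) + 1) div d)) of
            (x, d, e) \<Rightarrow> (tri ((x + 1) div 2), (x + 1) div 2, nat d)) = t"
      using * by (simp add: ikd)
    show "(case t of (i, k, d) \<Rightarrow> (2 * k - 1, int d, int ((2 * (n - i) + 1) div d))) \<in> S"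
      unfolding ikd prod.case e_def [symmetric]
      using \<open>d > 0\<close> \<open>e > 0\<close> de sq[of k] *(2) by (simp add: S_def M_def)
    have "(int d)\<^sup>2 * int e - int d * (2 * k - 1)\<^sup>2 = int d * (int d * int e - (2 * k - 1)\<^sup>2)"
      by (simp add: power2_eq_square algebra_simps)
    also have "\<dots> = 2 * ((int n - 5 * int i) * int d)"
      unfolding de sq *(2) by (simp add: algebra_simps)
    finally show "(case case t of (i, k, d) \<Rightarrow> (2 * k - 1, int d, int ((2 * (n - i) + 1) div d)) of
            (x, d, e) \<Rightarrow> d\<^sup>2 * e - d * x\<^sup>2) = (case t of (i, k, d) \<Rightarrow> 2 * ((int n - 5 * int i) * int d))"
      by (simp add: ikd e_def)
  next
    fix s assume s: "s \<in> S"
    obtain x d e where xde: "s = (x, d, e)" by (cases s)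
    have *: "d > 0" "e > 0" "x\<^sup>2 + 4 * d * e = M" using s by (auto simp: S_def xde)
    have "odd (x\<^sup>2 + 4 * d * e)" unfolding *(3) M_def by simp
    hence "odd x" by simp
    then obtain k where k: "x = 2 * k - 1"
      by (metis add_diff_cancel_right' diff_add_eq oddE one_add_one mult_2 distrib_left mult.right_neutral add_diff_eq)
    define i where "i = tri k"
    have de: "d * e = 2 * (int n - int i) + 1"
      using *(3) sq[of k] unfolding k M_def i_def by simp
    have "0 < d * e" using * by simp
    hence i: "i \<le> n" unfolding de by simp
    have nde: "nat d * nat e = 2 * (n - i) + 1"
      using de * i by (metis nat_mult_distrib nat_int of_nat_diff of_nat_mult of_nat_add of_nat_1 of_nat_numeral less_imp_le)
    have dvd: "nat d dvd 2 * (n - i) + 1" and quot: "(2 * (n - i) + 1) div nat d = nat e"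
      unfolding nde [symmetric] using * by simp_all
    show "(case case s of (x, d, e) \<Rightarrow> (tri ((x + 1) div 2), (x + 1) div 2, nat d) of
            (i, k, d) \<Rightarrow> (2 * k - 1, int d, int ((2 * (n - i) + 1) div d))) = s"
      using * quot by (simp add: xde k flip: i_def)
    show "(case s of (x, d, e) \<Rightarrow> (tri ((x + 1) div 2), (x + 1) div 2, nat d)) \<in> T"
      using i dvd by (simp add: xde k T_def flip: i_def)
  qed
  also have "\<dots> = 2 * (\<Sum>(i, k, d)\<in>T. (int n - 5 * int i) * int d)"
    by (simp add: sum_distrib_left case_prod_unfold)
  finally have "(\<Sum>(i, k, d)\<in>T. (int n - 5 * int i) * int d) = 0"
    using S0 by simp
  also have "(\<Sum>(i, k, d)\<in>T. (int n - 5 * int i) * int d) =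
      (\<Sum>i=0..n. \<Sum>(k, d)\<in>{k. tri k = i} \<times> {d. d dvd 2 * (n - i) + 1}. (int n - 5 * int i) * int d)"
    unfolding T_def
    by (subst sum.Sigma)
       (auto intro!: finite_cartesian_product finite_fibresD[OF finite_fibres_tri] simp: case_prod_unfold)
  also have "\<dots> = (\<Sum>i=0..n. int (card {k. tri k = i}) *
      ((int n - 5 * int i) * int (divisor_sum (2 * (n - i) + 1))))"
    by (simp add: divisor_sum_def sum_distrib_left flip: sum.cartesian_product)
  finally show ?thesis .
qed

section \<open>Legendre's formula\<close>

text \<open>The series \<open>psi\<close> of the introduction. Complex coefficients make room for a
  fifth root of unity later.\<close>

abbreviation tri_fps :: "complex fps" where
  "tri_fps \<equiv> gen_fps tri (\<lambda>_. 1)"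

text \<open>The differential equation says that \<open>G / psi^4\<close> has derivative 0. Its
  constant value is \<open>1/16\<close>, because \<open>psi\<close> has constant term 2.\<close>

theorem tri_fps_power4:
  "tri_fps ^ 4 = Abs_fps (\<lambda>n. 16 * of_nat (divisor_sum (2 * n + 1)))"
proof -
  define G :: "complex fps" where "G = Abs_fps (\<lambda>n. of_nat (divisor_sum (2 * n + 1)))"
  define I where "I = inverse tri_fps"
  have "{k. tri k = 0} = {0, 1}"
  proof -
    have "k = 0 \<or> k = 1" if "tri k = 0" for k
      using double_tri[of k] that by auto
    thus ?thesis by (auto simp: tri_def)
  qed
  hence psi0: "fps_nth tri_fps 0 = 2" by (simp add: gen_fps_def)
  \<comment> \<open>With the factor \<open>X\<close>, derivatives have coefficients
    \<open>i f_i\<close> without an index shift; the combined weight is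
    \<open>(n - i) - 4i = n - 5i\<close>.\<close>
  have "fps_X * (tri_fps * fps_deriv G) = fps_X * (4 * fps_deriv tri_fps * G)"
  proof (rule fps_ext)
    fix n
    have X: "fps_nth (fps_X * fps_deriv f) i = of_nat i * fps_nth f i" for f :: "complex fps" and i
      by (cases i) auto
    have "fps_nth (tri_fps * (fps_X * fps_deriv G)) n - 4 * fps_nth ((fps_X * fps_deriv tri_fps) * G) n =
       (\<Sum>i=0..n. of_int (int (card {k. tri k = i}) * ((int n - 5 * int i) * int (divisor_sum (2 * (n - i) + 1)))))"
      unfolding fps_mult_nth[of tri_fps] fps_mult_nth[of _ G] X sum_distrib_left sum_subtractf[symmetric]
      by (intro sum.cong refl) (simp add: G_def gen_fps_def of_nat_diff algebra_simps)
    also have "\<dots> = 0"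
      unfolding of_int_sum [symmetric] sum_tri_divisor_sum_eq_0 by simp
    finally have "fps_nth (tri_fps * (fps_X * fps_deriv G)) n =
        fps_nth (fps_const 4 * ((fps_X * fps_deriv tri_fps) * G)) n"
      unfolding fps_mult_left_const_nth by simp
    thus "fps_nth (fps_X * (tri_fps * fps_deriv G)) n =
        fps_nth (fps_X * (4 * fps_deriv tri_fps * G)) n"
      unfolding numeral_fps_const by (simp only: mult_ac)
  qed
  hence eq: "tri_fps * fps_deriv G = 4 * fps_deriv tri_fps * G"
    by simp
  have inv: "tri_fps * I = 1"
    using psi0 by (simp add: I_def inverse_mult_eq_1')
  have "fps_deriv I = - fps_deriv tri_fps * I\<^sup>2"
    unfolding I_def by (rule fps_inverse_deriv) (simp add: psi0)
  hence "fps_deriv (G * I ^ 4) = fps_deriv G * I ^ 4 - 4 * G * I ^ 5 * fps_deriv tri_fps"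
    by (simp add: fps_deriv_power)
  also have "\<dots> = I ^ 5 * (tri_fps * fps_deriv G - 4 * fps_deriv tri_fps * G)"
    using inv by algebra
  finally have "fps_deriv (G * I ^ 4) = 0"
    by (simp add: eq)
  hence "G * I ^ 4 = fps_const (fps_nth (G * I ^ 4) 0)"
    by (simp only: fps_deriv_eq_0_iff)
  also have "fps_nth (G * I ^ 4) 0 = 1 / 16"
    by (simp add: G_def I_def psi0 divisor_sum_def fps_nth_power_0 power_divide)
  finally have "fps_const 16 * (G * I ^ 4) = 1"
    by simp
  hence "tri_fps ^ 4 = fps_const 16 * G"
    using inv by algebra
  thus ?thesis
    by (simp add: G_def fps_eq_iff)
qed

section \<open>Pairs of triangular numbers modulo 5\<close>

text \<open>Modulo \<open>2 - i\<close> one has \<open>i = 2\<close>, so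
  \<open>(2k-1) + (2l-1)i\<close> has residue \<open>2(k + 2l + 1)\<close> modulo 5. This is the
  origin of the \<open>+ 1\<close>.\<close>

definition tri_pairs :: "int \<Rightarrow> nat \<Rightarrow> (int \<times> int) set" where
  "tri_pairs r n = {(k, l). tri k + tri l = n \<and> (k + 2 * l + 1) mod 5 = r}"

definition class_fps :: "int \<Rightarrow> complex fps" where
  "class_fps r = Abs_fps (\<lambda>n. of_nat (card (tri_pairs r n)))"

text \<open>Multiplication by \<open>i\<close> sends \<open>(k, l)\<close> to
  \<open>(1 - l, k)\<close>; it keeps the norm and doubles the class.\<close>

lemma class_fps_double:
  assumes "r \<in> {0..4}"
  shows "class_fps ((2 * r) mod 5) = class_fps r"
proof -
  have cls: "(2 + (2 * k - l)) mod 5 = (2 * ((k + 2 * l + 1) mod 5)) mod 5" for k l :: int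
  proof -
    have "2 * (k + 2 * l + 1) = (2 + (2 * k - l)) + 5 * l" by simp
    thus ?thesis unfolding mod_mult_right_eq by (simp only: mod_mult_self2)
  qed
  \<comment> \<open>The inverse map: 3 is the inverse of 2 modulo 5.\<close>
  have cls': "(3 + (l - 2 * k)) mod 5 = r" if "(k + 2 * l + 1) mod 5 = (2 * r) mod 5" for k l
  proof -
    have "3 * (k + 2 * l + 1) = (3 + (l - 2 * k)) + 5 * (k + l)" by simp
    hence "(3 + (l - 2 * k)) mod 5 = (3 * (k + 2 * l + 1)) mod 5"
      by (simp only: mod_mult_self2)
    also have "\<dots> = (3 * ((2 * r) mod 5)) mod 5"
      by (simp only: that [symmetric] mod_mult_right_eq)
    also have "r \<in> {0, 1, 2, 3, 4}" using assms by auto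
    hence "(3 * ((2 * r) mod 5)) mod 5 = r" by auto
    finally show ?thesis .
  qed
  have "bij_betw (\<lambda>(k, l). (1 - l, k)) (tri_pairs r n) (tri_pairs ((2 * r) mod 5) n)" for n
  proof (rule bij_betwI[where g = "\<lambda>(k, l). (l, 1 - k)"])
    show "(\<lambda>(k, l). (1 - l, k)) \<in> tri_pairs r n \<rightarrow> tri_pairs ((2 * r) mod 5) n"
      by (auto simp: tri_pairs_def tri_diff cls)
    show "(\<lambda>(k, l). (l, 1 - k)) \<in> tri_pairs ((2 * r) mod 5) n \<rightarrow> tri_pairs r n"
      using assms by (auto simp: tri_pairs_def tri_diff cls')
  qed auto
  hence "card (tri_pairs r n) = card (tri_pairs ((2 * r) mod 5) n)" for n
    by (rule bij_betw_same_card)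
  thus ?thesis by (simp add: class_fps_def)
qed

lemma class_fps_eq_1:
  "class_fps 2 = class_fps 1" "class_fps 3 = class_fps 1" "class_fps 4 = class_fps 1"
  using class_fps_double[of 1] class_fps_double[of 2] class_fps_double[of 4] by simp_all

text \<open>The bijection is multiplication of \<open>(2m-1) + (2v-1)i\<close> by
  \<open>2 - i\<close>. The norm is \<open>8 (tri m + tri v) + 2\<close>; multiplying it by 5
  explains both the factor 5 and the extra \<open>X\<close>.\<close>

lemma class_fps_0:
  "class_fps 0 = fps_X * (gen_fps (\<lambda>k. 5 * tri k) (\<lambda>_. 1))\<^sup>2"
proof (rule fps_ext)
  fix n
  define B where "B = {(m, v). 5 * tri m + 5 * tri v + 1 = n}"
  have tri5: "tri (2 * m + v - 1) + tri (2 * v - m) = 5 * tri m + 5 * tri v + 1" for m v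
  proof -
    have "int (tri (2 * m + v - 1) + tri (2 * v - m)) = int (5 * tri m + 5 * tri v + 1)"
      using double_tri[of "2 * m + v - 1"] double_tri[of "2 * v - m"] double_tri[of m] double_tri[of v]
      by (simp add: algebra_simps)
    thus ?thesis by linarith
  qed
  have "bij_betw (\<lambda>(m, v). (2 * m + v - 1, 2 * v - m)) B (tri_pairs 0 n)"
  proof (rule bij_betwI[where g = "\<lambda>(k, l). ((2 * k - l + 2) div 5, (k + 2 * l + 1) div 5)"])
    show "(\<lambda>(m, v). (2 * m + v - 1, 2 * v - m)) \<in> B \<rightarrow> tri_pairs 0 n"
      by (auto simp: B_def tri_pairs_def tri5)
    have inv: "2 * ((2 * k - l + 2) div 5) + (k + 2 * l + 1) div 5 - 1 = k"
      "2 * ((k + 2 * l + 1) div 5) - (2 * k - l + 2) div 5 = l" if "(k + 2 * l + 1) mod 5 = 0" for k l :: int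
    proof -
      have "5 dvd k + 2 * l + 1" using that by (simp only: dvd_eq_mod_eq_0)
      then obtain v where v: "k + 2 * l + 1 = 5 * v" by (rule dvdE)
      hence v': "2 * k - l + 2 = 5 * (2 * v - l)" by algebra
      have d: "(k + 2 * l + 1) div 5 = v" "(2 * k - l + 2) div 5 = 2 * v - l"
        unfolding v v' by simp_all
      show "2 * ((2 * k - l + 2) div 5) + (k + 2 * l + 1) div 5 - 1 = k"
        "2 * ((k + 2 * l + 1) div 5) - (2 * k - l + 2) div 5 = l"
        unfolding d using v by (algebra, simp)
    qed
    show "(\<lambda>(k, l). ((2 * k - l + 2) div 5, (k + 2 * l + 1) div 5)) \<in> tri_pairs 0 n \<rightarrow> B"
    proof
      fix p assume "p \<in> tri_pairs 0 n"
      then obtain k l where kl: "p = (k, l)" "tri k + tri l = n" "(k + 2 * l + 1) mod 5 = 0"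
        by (auto simp: tri_pairs_def)
      show "(case p of (k, l) \<Rightarrow> ((2 * k - l + 2) div 5, (k + 2 * l + 1) div 5)) \<in> B"
        using kl(2) tri5[of "(2 * k - l + 2) div 5" "(k + 2 * l + 1) div 5"]
        unfolding inv[OF kl(3)] kl(1) B_def by simp
    qed
    show "(case case p of (m, v) \<Rightarrow> (2 * m + v - 1, 2 * v - m) of
        (k, l) \<Rightarrow> ((2 * k - l + 2) div 5, (k + 2 * l + 1) div 5)) = p" for p :: "int \<times> int"
      by (cases p) simp
    show "(case case p of (k, l) \<Rightarrow> ((2 * k - l + 2) div 5, (k + 2 * l + 1) div 5) of
        (m, v) \<Rightarrow> (2 * m + v - 1, 2 * v - m)) = p" if p: "p \<in> tri_pairs 0 n" for p
    proof -
      obtain k l where kl: "p = (k, l)" "(k + 2 * l + 1) mod 5 = 0"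
        using p by (auto simp: tri_pairs_def)
      show ?thesis unfolding kl(1) prod.case inv[OF kl(2)] ..
    qed
  qed
  hence "card (tri_pairs 0 n) = card B"
    by (rule bij_betw_same_card [symmetric])
  also have "of_nat (card B) = fps_nth (fps_X * (gen_fps (\<lambda>k. 5 * tri k) (\<lambda>_. 1 :: complex))\<^sup>2) n"
    using finite_fibres_theta[of 0 5]
    by (cases n) (simp_all add: power2_eq_square gen_fps_mult, simp_all add: gen_fps_def B_def case_prod_unfold)
  finally show "fps_nth (class_fps 0) n =
      fps_nth (fps_X * (gen_fps (\<lambda>k. 5 * tri k) (\<lambda>_. 1))\<^sup>2) n"
    by (simp add: class_fps_def)
qed

text \<open>Class 1 means \<open>5 dvd k + 2l\<close>, so \<open>k = a + 2b\<close>,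
  \<open>l = 2a - b\<close> is a homogeneous substitution. Its cross terms cancel and the exponent
  separates into \<open>(5a^2 - 3a)/2\<close> and \<open>(5b^2 - b)/2\<close>.\<close>

lemma class_fps_1:
  "class_fps 1 = ramanujan_theta 1 1 4 * ramanujan_theta 1 2 3"
proof (rule fps_ext)
  fix n
  define B where "B = {(a, b). 1 * tri (a + 1) + 4 * tri a + (2 * tri (b + 1) + 3 * tri b) = n}"
  have tri5: "tri (a + 2 * b) + tri (2 * a - b) = 1 * tri (a + 1) + 4 * tri a + (2 * tri (b + 1) + 3 * tri b)" for a b
  proof -
    have "int (tri (a + 2 * b) + tri (2 * a - b)) = int (1 * tri (a + 1) + 4 * tri a + (2 * tri (b + 1) + 3 * tri b))"
      using double_tri[of "a + 2 * b"] double_tri[of "2 * a - b"] double_tri[of a] double_tri[of b]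
        tri_add_1[of a] tri_add_1[of b]
      by (simp add: algebra_simps)
    thus ?thesis by linarith
  qed
  have "bij_betw (\<lambda>(a, b). (a + 2 * b, 2 * a - b)) B (tri_pairs 1 n)"
  proof (rule bij_betwI[where g = "\<lambda>(k, l). ((k + 2 * l) div 5, (2 * k - l) div 5)"])
    show "(\<lambda>(a, b). (a + 2 * b, 2 * a - b)) \<in> B \<rightarrow> tri_pairs 1 n"
      by (auto simp: B_def tri_pairs_def tri5)
    have inv: "(k + 2 * l) div 5 + 2 * ((2 * k - l) div 5) = k"
      "2 * ((k + 2 * l) div 5) - (2 * k - l) div 5 = l" if "(k + 2 * l + 1) mod 5 = 1" for k l :: int
    proof -
      have "5 dvd k + 2 * l + 1 - 1" using that by (simp only: flip: mod_eq_dvd_iff) simp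
      then obtain v where "k + 2 * l + 1 - 1 = 5 * v" by (rule dvdE)
      hence v: "k + 2 * l = 5 * v" and v': "2 * k - l = 5 * (2 * v - l)" by (simp, algebra)
      have d: "(k + 2 * l) div 5 = v" "(2 * k - l) div 5 = 2 * v - l"
        unfolding v v' by simp_all
      show "(k + 2 * l) div 5 + 2 * ((2 * k - l) div 5) = k"
        "2 * ((k + 2 * l) div 5) - (2 * k - l) div 5 = l"
        unfolding d using v by (algebra, simp)
    qed
    show "(\<lambda>(k, l). ((k + 2 * l) div 5, (2 * k - l) div 5)) \<in> tri_pairs 1 n \<rightarrow> B"
    proof
      fix p assume "p \<in> tri_pairs 1 n"
      then obtain k l where kl: "p = (k, l)" "tri k + tri l = n" "(k + 2 * l + 1) mod 5 = 1"
        by (auto simp: tri_pairs_def)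
      show "(case p of (k, l) \<Rightarrow> ((k + 2 * l) div 5, (2 * k - l) div 5)) \<in> B"
        using kl(2) tri5[of "(k + 2 * l) div 5" "(2 * k - l) div 5"]
        unfolding inv[OF kl(3)] kl(1) B_def by simp
    qed
    show "(case case p of (a, b) \<Rightarrow> (a + 2 * b, 2 * a - b) of
        (k, l) \<Rightarrow> ((k + 2 * l) div 5, (2 * k - l) div 5)) = p" for p :: "int \<times> int"
      by (cases p) simp
    show "(case case p of (k, l) \<Rightarrow> ((k + 2 * l) div 5, (2 * k - l) div 5) of
        (a, b) \<Rightarrow> (a + 2 * b, 2 * a - b)) = p" if p: "p \<in> tri_pairs 1 n" for p
    proof -
      obtain k l where kl: "p = (k, l)" "(k + 2 * l + 1) mod 5 = 1"
        using p by (auto simp: tri_pairs_def)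
      show ?thesis unfolding kl(1) prod.case inv[OF kl(2)] ..
    qed
  qed
  hence "card (tri_pairs 1 n) = card B"
    by (rule bij_betw_same_card [symmetric])
  also have "of_nat (card B) = fps_nth (ramanujan_theta 1 1 4 * ramanujan_theta (1 :: complex) 2 3) n"
    unfolding ramanujan_theta_def
    by (subst gen_fps_mult[OF finite_fibres_theta finite_fibres_theta])
       (simp_all add: gen_fps_def B_def case_prod_unfold)
  finally show "fps_nth (class_fps 1) n =
      fps_nth (ramanujan_theta 1 1 4 * ramanujan_theta 1 2 3) n"
    by (simp add: class_fps_def)
qed

lemma finite_tri_pairs: "finite {(k, l). tri k + tri l = n}"
  using finite_fibresD[OF finite_fibres_add[OF finite_fibres_tri finite_fibres_tri], of n]
  by (simp add: case_prod_unfold)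

text \<open>Used with constant \<open>f\<close> for \<open>psi^2\<close> and with powers of a root
  of unity for the twisted theta product.\<close>

lemma sum_tri_pairs_by_class:
  fixes f :: "int \<Rightarrow> complex"
  shows "(\<Sum>(k, l) | tri k + tri l = n. f ((k + 2 * l + 1) mod 5)) =
    fps_nth (class_fps 0) n * f 0 + fps_nth (class_fps 1) n * (f 1 + f 2 + f 3 + f 4)"
proof -
  define S where "S = {(k, l). tri k + tri l = n}"
  have "(\<Sum>(k, l)\<in>S. f ((k + 2 * l + 1) mod 5)) =
      (\<Sum>r\<in>{0..4}. \<Sum>(k, l)\<in>{p \<in> S. (fst p + 2 * snd p + 1) mod 5 = r}. f ((k + 2 * l + 1) mod 5))"
    by (rule sum.group [symmetric]) (use finite_tri_pairs[of n] in \<open>auto simp: S_def\<close>)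
  also have "\<dots> = (\<Sum>r\<in>{0..4}. fps_nth (class_fps r) n * f r)"
  proof (rule sum.cong)
    fix r :: int
    have "{p \<in> S. (fst p + 2 * snd p + 1) mod 5 = r} = tri_pairs r n"
      by (auto simp: S_def tri_pairs_def)
    moreover have "(\<Sum>(k, l)\<in>tri_pairs r n. f ((k + 2 * l + 1) mod 5)) = (\<Sum>p\<in>tri_pairs r n. f r)"
      by (rule sum.cong) (auto simp: tri_pairs_def)
    ultimately show "(\<Sum>(k, l)\<in>{p \<in> S. (fst p + 2 * snd p + 1) mod 5 = r}. f ((k + 2 * l + 1) mod 5)) =
        fps_nth (class_fps r) n * f r"
      by (simp add: class_fps_def)
  qed auto
  also have "{0..4} = {0, 1, 2, 3, 4 :: int}" by auto
  finally show ?thesis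
    by (simp add: S_def class_fps_eq_1 algebra_simps)
qed

lemma tri_fps_square: "tri_fps\<^sup>2 = class_fps 0 + 4 * class_fps 1"
proof (rule fps_ext)
  fix n
  have "fps_nth (tri_fps\<^sup>2) n = (\<Sum>(k, l) | tri k + tri l = n. 1)"
    unfolding power2_eq_square gen_fps_mult[OF finite_fibres_tri finite_fibres_tri]
    by (simp add: gen_fps_def case_prod_unfold)
  also have "\<dots> = fps_nth (class_fps 0 + 4 * class_fps 1) n"
    using sum_tri_pairs_by_class[of "\<lambda>_. 1" n] by (simp add: numeral_fps_const)
  finally show "fps_nth (tri_fps\<^sup>2) n = fps_nth (class_fps 0 + 4 * class_fps 1) n" .
qed

text \<open>The weight \<open>z^(k+2l)\<close> is \<open>z^4\<close> times \<open>z\<close> to the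
  class of \<open>(k, l)\<close>. The four equal nonzero classes together get
  \<open>z + z^2 + z^3 + z^4 = -1\<close>.\<close>

lemma theta_root_of_unity_product:
  fixes z :: complex
  assumes z: "z ^ 5 = 1" "z \<noteq> 1"
  shows "ramanujan_theta z 0 1 * ramanujan_theta (z\<^sup>2) 0 1 = fps_const (z ^ 4) * (class_fps 0 - class_fps 1)"
proof (rule fps_ext)
  fix n
  have z0: "z \<noteq> 0" using z by auto
  have weight: "z powi k * z\<^sup>2 powi l = z ^ 4 * z powi ((k + 2 * l + 1) mod 5)" for k l
  proof -
    define m where "m = (k + 2 * l + 1) div 5 - 1"
    define r where "r = (k + 2 * l + 1) mod 5"
    have "5 * (m + 1) + r = k + 2 * l + 1"
      by (simp only: m_def r_def diff_add_cancel mult_div_mod_eq)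
    hence "k + 2 * l = 4 + 5 * m + r" by simp
    hence "z powi (k + 2 * l) = z powi 4 * (z powi 5) powi m * z powi r"
      using z0 by (simp add: power_int_add power_int_mult)
    moreover have "z powi 5 = 1" "z powi 4 = z ^ 4"
      using z by simp_all
    moreover have "z powi k * z\<^sup>2 powi l = z powi (k + 2 * l)"
      using z0 by (simp add: power_int_add power_int_mult)
    ultimately show ?thesis by (simp add: r_def)
  qed
  have "(z - 1) * (1 + z + z\<^sup>2 + z ^ 3 + z ^ 4) = z ^ 5 - 1" by algebra
  hence sum0: "1 + z + z\<^sup>2 + z ^ 3 + z ^ 4 = 0" using z by simp
  have pows: "z powi 2 = z\<^sup>2" "z powi 3 = z ^ 3" "z powi 4 = z ^ 4"
    by simp_all
  have "fps_nth (ramanujan_theta z 0 1 * ramanujan_theta (z\<^sup>2) 0 1) n =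
      (\<Sum>(k, l) | tri k + tri l = n. z powi k * z\<^sup>2 powi l)"
    unfolding ramanujan_theta_def using finite_fibres_tri
    by (simp add: gen_fps_mult) (simp add: gen_fps_def case_prod_unfold)
  also have "\<dots> = z ^ 4 * (\<Sum>(k, l) | tri k + tri l = n. z powi ((k + 2 * l + 1) mod 5))"
    unfolding weight by (simp add: sum_distrib_left case_prod_unfold)
  also have "\<dots> = z ^ 4 * (fps_nth (class_fps 0) n + fps_nth (class_fps 1) n * (z + z\<^sup>2 + z ^ 3 + z ^ 4))"
    unfolding sum_tri_pairs_by_class by (simp add: pows)
  also have "z + z\<^sup>2 + z ^ 3 + z ^ 4 = - 1"
    using sum0 by algebra
  finally show "fps_nth (ramanujan_theta z 0 1 * ramanujan_theta (z\<^sup>2) 0 1) n =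
      fps_nth (fps_const (z ^ 4) * (class_fps 0 - class_fps 1)) n"
    by simp
qed

section \<open>The product formula\<close>

lemma prod_lessThan_5_mult:
  fixes f :: "nat \<Rightarrow> 'a :: comm_monoid_mult"
  shows "(\<Prod>i<5 * n. f i) =
    (\<Prod>i<n. f (5 * i) * f (5 * i + 1) * f (5 * i + 2) * f (5 * i + 3) * f (5 * i + 4))"
proof (induction n)
  case (Suc n)
  have *: "5 * Suc n = Suc (Suc (Suc (Suc (Suc (5 * n)))))" "5 * n + 1 = Suc (5 * n)"
    "5 * n + 2 = Suc (Suc (5 * n))" "5 * n + 3 = Suc (Suc (Suc (5 * n)))"
    "5 * n + 4 = Suc (Suc (Suc (Suc (5 * n))))" by simp_all
  show ?case unfolding prod.lessThan_Suc * Suc by (simp only: mult_ac)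
qed auto

text \<open>The two theta products supply the factors \<open>1 + X^i\<close> with \<open>i\<close>
  prime to 5; the extra product supplies the multiples of 5.\<close>

lemma class_fps_1_agree:
  assumes "2 * N + 1 \<le> n"
  shows "fps_agree N (class_fps 1 * (\<Prod>i<n. 1 + fps_X ^ (5 * Suc i)))
    ((\<Prod>i<n. 1 - fps_X ^ (5 * Suc i))\<^sup>2 * (\<Prod>i<5 * n. 1 + fps_X ^ Suc i))"
proof -
  define D :: "complex fps" where "D = (\<Prod>i<n. 1 - fps_X ^ (5 * Suc i))"
  define V :: "complex fps" where "V = (\<Prod>i<n. 1 + fps_X ^ (5 * Suc i))"
  define P :: "nat \<Rightarrow> complex fps" where "P = (\<lambda>j. \<Prod>i<n. 1 + fps_X ^ (5 * i + j))"
  have mono: "(fps_const 1 * fps_X ^ r) ^ i * (fps_const (inverse 1) * fps_X ^ s) ^ j =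
      (fps_X ^ (r * i + s * j) :: complex fps)" for r s i j
    by (simp add: power_add power_mult)
  have exps: "1 * i + 4 * Suc i = 5 * i + 4" "1 * Suc i + 4 * i = 5 * i + 1"
    "2 * i + 3 * Suc i = 5 * i + 3" "2 * Suc i + 3 * i = 5 * i + 2" for i :: nat
    by simp_all
  have "fps_agree N (ramanujan_theta 1 1 4) (D * (P 4 * P 1))"
    using triple_product_agree[of "1 :: complex" 1 4 N n n n] assms
    unfolding mono exps by (simp add: D_def P_def)
  moreover have "fps_agree N (ramanujan_theta 1 2 3) (D * (P 3 * P 2))"
    using triple_product_agree[of "1 :: complex" 2 3 N n n n] assms
    unfolding mono exps by (simp add: D_def P_def)
  ultimately have "fps_agree N (class_fps 1 * V) (D * (P 4 * P 1) * (D * (P 3 * P 2)) * V)"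
    unfolding class_fps_1 by (intro fps_agree_mult fps_agree_refl)
  also have "V = P 5"
    unfolding V_def P_def by (intro prod.cong refl) (simp add: add.commute)
  also have "D * (P 4 * P 1) * (D * (P 3 * P 2)) * P 5 = D\<^sup>2 * (P 1 * P 2 * P 3 * P 4 * P 5)"
    by (simp add: power2_eq_square mult_ac)
  also have "P 1 * P 2 * P 3 * P 4 * P 5 = (\<Prod>i<5 * n. 1 + fps_X ^ Suc i)"
    unfolding P_def prod.distrib[symmetric] prod_lessThan_5_mult
    by (intro prod.cong refl) (simp add: eval_nat_numeral)
  finally show ?thesis using \<open>V = P 5\<close> by (simp add: D_def V_def)
qed

text \<open>With \<open>r = 0\<close> the first factor of the last product is the constant
  \<open>1 + z\<close>; splitting it off is why that product has \<open>Suc M\<close>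
  factors.\<close>

lemma theta_root_of_unity_agree:
  fixes z :: "'a :: field"
  assumes "2 * N + 1 \<le> M" "z \<noteq> 0"
  shows "fps_agree N (ramanujan_theta z 0 1)
    (fps_const (1 + z) * (\<Prod>i<M. 1 - fps_X ^ Suc i) *
      (\<Prod>i<M. (1 + fps_const z * fps_X ^ Suc i) * (1 + fps_const (inverse z) * fps_X ^ Suc i)))"
proof -
  have mono: "(fps_const z * fps_X ^ 0) ^ i * (fps_const (inverse z) * fps_X ^ 1) ^ Suc i =
      fps_const (inverse z) * fps_X ^ Suc i"
    "(fps_const z * fps_X ^ 0) ^ Suc i * (fps_const (inverse z) * fps_X ^ 1) ^ i =
      fps_const z * fps_X ^ i" for i
    using assms by (simp_all add: power_mult_distrib fps_const_power field_simps flip: fps_const_mult)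
  have c1: "fps_const (1 + z) = 1 + fps_const z" by (simp flip: fps_const_add)
  show ?thesis
    using triple_product_agree[of z 0 1 N M M "Suc M"] assms
    unfolding mono prod.lessThan_Suc_shift c1 by (simp add: prod.distrib mult_ac)
qed

text \<open>The theta series at \<open>z\<close> and \<open>z^2\<close> carry the pairs
  \<open>z, z^4\<close> and \<open>z^2, z^3\<close>. With the factor \<open>1 + y\<close> they
  complete the product of \<open>1 + z^j y\<close> over all fifth roots of unity, which is
  \<open>1 + y^5\<close>.\<close>

lemma class_fps_diff_agree:
  assumes "2 * N + 1 \<le> M"
  shows "fps_agree N ((class_fps 1 - class_fps 0) * (\<Prod>i<M. 1 + fps_X ^ Suc i))
    ((\<Prod>i<M. 1 - fps_X ^ Suc i)\<^sup>2 * (\<Prod>i<M. 1 + fps_X ^ (5 * Suc i)))"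
proof -
  define z where "z = cis (2 * pi / 5)"
  have "z ^ 5 = cis (real 5 * (2 * pi / 5))" unfolding z_def by (rule Complex.DeMoivre)
  hence z5: "z ^ 5 = 1" by simp
  have "z \<noteq> 1"
  proof
    assume "z = 1"
    hence "Im z = 0" by simp
    hence "sin (2 * pi / 5) = 0" by (simp add: z_def)
    moreover have "sin (2 * pi / 5) > 0" by (rule sin_gt_zero) auto
    ultimately show False by simp
  qed
  have z0: "z \<noteq> 0" by (simp add: z_def)
  have inv: "inverse z = z ^ 4" "inverse (z\<^sup>2) = z ^ 3"
    using z5 z0 by (simp_all add: field_simps flip: power_Suc power_add)
  define Z where "Z = fps_const z"
  have Zpow: "fps_const (z ^ k) = Z ^ k" for k by (simp add: Z_def fps_const_power)
  have "(z - 1) * (1 + z + z\<^sup>2 + z ^ 3 + z ^ 4) = z ^ 5 - 1" by algebra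
  hence "1 + z + z\<^sup>2 + z ^ 3 + z ^ 4 = 0" using z5 \<open>z \<noteq> 1\<close> by simp
  hence "fps_const (1 + z + z\<^sup>2 + z ^ 3 + z ^ 4) = 0" by simp
  hence Zsum: "1 + Z + Z\<^sup>2 + Z ^ 3 + Z ^ 4 = 0"
    unfolding fps_const_add[symmetric] Zpow by (simp add: Z_def)
  have Z5: "Z ^ 5 = 1" using z5 by (simp flip: Zpow)
  define U :: "complex fps" where "U = (\<Prod>i<M. 1 - fps_X ^ Suc i)"
  define W :: "complex fps" where "W = (\<Prod>i<M. 1 + fps_X ^ Suc i)"
  define V :: "complex fps" where "V = (\<Prod>i<M. 1 + fps_X ^ (5 * Suc i))"
  define A where "A = (\<Prod>i<M. (1 + Z * fps_X ^ Suc i) * (1 + Z ^ 4 * fps_X ^ Suc i))"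
  define B where "B = (\<Prod>i<M. (1 + Z\<^sup>2 * fps_X ^ Suc i) * (1 + Z ^ 3 * fps_X ^ Suc i))"
  have "fps_agree N (ramanujan_theta z 0 1) ((1 + Z) * U * A)"
    using theta_root_of_unity_agree[OF assms z0]
    by (simp add: inv Zpow A_def U_def Z_def flip: fps_const_add del: power_Suc fps_const_power)
  moreover have "fps_agree N (ramanujan_theta (z\<^sup>2) 0 1) ((1 + Z\<^sup>2) * U * B)"
    using theta_root_of_unity_agree[OF assms, of "z\<^sup>2"] z0
    unfolding inv Zpow fps_const_add[symmetric] by (simp add: U_def B_def del: power_Suc)
  \<comment> \<open>The multiplier \<open>-Z\<close> removes both units:
    \<open>-Z * Z^4 = -1\<close> reverses the difference, and
    \<open>-Z (1 + Z) (1 + Z^2) = 1\<close>.\<close>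
  ultimately have "fps_agree N (- Z * W * (ramanujan_theta z 0 1 * ramanujan_theta (z\<^sup>2) 0 1))
      (- Z * W * (((1 + Z) * U * A) * ((1 + Z\<^sup>2) * U * B)))"
    by (intro fps_agree_mult fps_agree_refl)
  also have "- Z * W * (ramanujan_theta z 0 1 * ramanujan_theta (z\<^sup>2) 0 1) = (class_fps 1 - class_fps 0) * W"
    unfolding theta_root_of_unity_product[OF z5 \<open>z \<noteq> 1\<close>] Zpow using Z5 by algebra
  also have "- Z * W * (((1 + Z) * U * A) * ((1 + Z\<^sup>2) * U * B)) = U\<^sup>2 * (W * A * B)"
    using Zsum Z5 by algebra
  also have "W * A * B = V"
  proof -
    have "(1 + y) * ((1 + Z * y) * (1 + Z ^ 4 * y)) * ((1 + Z\<^sup>2 * y) * (1 + Z ^ 3 * y)) = 1 + y ^ 5" for y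
      using Zsum by algebra
    from this[of "fps_X ^ Suc i" for i] show ?thesis
      unfolding W_def A_def B_def V_def prod.distrib[symmetric]
      by (intro prod.cong refl) (simp only: mult.commute[of 5] power_mult)
  qed
  finally show ?thesis by (simp add: U_def V_def W_def)
qed

text \<open>Multiply the two evaluations and cancel the invertible \<open>E\<close>. The first
  leaves \<open>5n\<close> factors in \<open>W\<close>, so the second is taken at length
  \<open>5n\<close>, and its surplus factors, being 1 up to degree \<open>N\<close>, are
  dropped.\<close>

theorem class_fps_product_agree:
  assumes n: "2 * N + 1 \<le> n"
  shows "fps_agree N (class_fps 1 * (class_fps 1 - class_fps 0))
    (\<Prod>i<n. (1 - fps_X ^ Suc i)\<^sup>2 * (1 - fps_X ^ (5 * Suc i))\<^sup>2)"
proof -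
  define D :: "complex fps" where "D = (\<Prod>i<n. 1 - fps_X ^ (5 * Suc i))"
  define U :: "nat \<Rightarrow> complex fps" where "U = (\<lambda>n. \<Prod>i<n. 1 - fps_X ^ Suc i)"
  define V :: "nat \<Rightarrow> complex fps" where "V = (\<lambda>n. \<Prod>i<n. 1 + fps_X ^ (5 * Suc i))"
  define W :: "complex fps" where "W = (\<Prod>i<5 * n. 1 + fps_X ^ Suc i)"
  define E where "E = V n * W"
  have "fps_nth (V n) 0 = 1" unfolding V_def by (induction n) auto
  moreover have "fps_nth (\<Prod>i<m. 1 + fps_X ^ Suc i :: complex fps) 0 = 1" for m
    by (induction m) auto
  ultimately have "fps_nth E 0 = 1" by (simp add: E_def W_def)
  hence E: "E * inverse E = 1" by (simp add: inverse_mult_eq_1')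
  have V: "fps_agree N (V (5 * n)) (V n)"
    unfolding V_def
    by (rule fps_agree_sym, rule fps_agree_prod_tail)
       (use n in \<open>auto intro!: fps_agree_one_plus(3) simp del: power_Suc\<close>)
  have U: "fps_agree N (U (5 * n)) (U n)"
    unfolding U_def
    by (rule fps_agree_sym, rule fps_agree_prod_tail)
       (use n in \<open>auto intro!: fps_agree_one_plus(2) simp del: power_Suc mult_Suc_right\<close>)
  have "fps_agree N (class_fps 1 * V n) (D\<^sup>2 * W)"
    using class_fps_1_agree[OF n] by (simp only: D_def V_def W_def)
  moreover have "fps_agree N ((class_fps 1 - class_fps 0) * W) ((U n)\<^sup>2 * V n)"
  proof (rule fps_agree_trans)
    show "fps_agree N ((class_fps 1 - class_fps 0) * W) ((U (5 * n))\<^sup>2 * V (5 * n))"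
      using class_fps_diff_agree[of N "5 * n"] n by (simp add: U_def V_def W_def)
    show "fps_agree N ((U (5 * n))\<^sup>2 * V (5 * n)) ((U n)\<^sup>2 * V n)"
      unfolding power2_eq_square by (intro fps_agree_mult U V)
  qed
  ultimately have "fps_agree N ((class_fps 1 * V n) * ((class_fps 1 - class_fps 0) * W) * inverse E)
      ((D\<^sup>2 * W) * ((U n)\<^sup>2 * V n) * inverse E)"
    by (rule fps_agree_mult[OF fps_agree_mult fps_agree_refl])
  also have "(class_fps 1 * V n) * ((class_fps 1 - class_fps 0) * W) * inverse E =
      class_fps 1 * (class_fps 1 - class_fps 0)"
    using E unfolding E_def by algebra
  also have "(D\<^sup>2 * W) * ((U n)\<^sup>2 * V n) * inverse E = (U n)\<^sup>2 * D\<^sup>2"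
    using E unfolding E_def by algebra
  finally show ?thesis
    by (simp only: U_def D_def prod.distrib prod_power_distrib)
qed

lemma fps_nth_compose_X_power:
  fixes f :: "'a :: comm_ring_1 fps"
  assumes "d > 0"
  shows "fps_nth (f oo fps_X ^ d) n = (if d dvd n then fps_nth f (n div d) else 0)"
proof -
  have "fps_nth (f oo fps_X ^ d) n = (\<Sum>i=0..n. if n = d * i then fps_nth f i else 0)"
    unfolding fps_compose_nth power_mult [symmetric]
    by (intro sum.cong refl) (auto simp: fps_X_power_iff)
  also have "\<dots> = (\<Sum>i\<in>(if d dvd n then {n div d} else {}). fps_nth f i)"
    using assms by (intro sum.mono_neutral_cong_right) (auto split: if_splits intro: div_le_dividend)
  finally show ?thesis by simp
qed

text \<open>The eta product is \<open>X\<close> times the preceding product evaluated at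
  \<open>X^2\<close>, whence the index \<open>2N + 1\<close>.\<close>

theorem eta_coeff_class_fps:
  "of_int (eta_coeff (2 * N + 1)) = fps_nth (class_fps 1 * (class_fps 1 - class_fps 0)) N"
proof -
  define h :: "nat \<Rightarrow> complex fps" where "h = (\<lambda>k. (1 - fps_X ^ Suc k)\<^sup>2 * (1 - fps_X ^ (5 * Suc k))\<^sup>2)"
  define g :: "nat \<Rightarrow> complex fps" where "g = (\<lambda>k. (1 - fps_X ^ (2 * Suc k))\<^sup>2 * (1 - fps_X ^ (10 * Suc k))\<^sup>2)"
  have X2: "fps_nth (fps_X\<^sup>2 :: complex fps) 0 = 0" by simp
  have exps: "2 * (5 * Suc k) = 10 * Suc k" for k :: nat by simp
  have "h k oo fps_X\<^sup>2 = g k" for k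
    unfolding h_def g_def fps_compose_mult_distrib[OF X2] fps_compose_power[OF X2, symmetric]
      fps_compose_sub_distrib fps_compose_1 fps_X_fps_compose_startby0[OF X2]
    by (simp only: power_mult [symmetric] exps)
  hence comp: "(\<Prod>k<n. h k) oo fps_X\<^sup>2 = (\<Prod>k<n. g k)" for n
    by (simp add: fps_compose_prod_distrib[OF X2])
  \<comment> \<open>One \<open>n\<close> large enough both for the coefficient to have stabilised
    and for \<open>class_fps_product_agree\<close>.\<close>
  obtain n where n: "n \<ge> 2 * N + 1" and "eta_coeff (2 * N + 1) = fps_nth
     (fps_X * (\<Prod>k<n. (1 - fps_X ^ (2 * Suc k))\<^sup>2 * (1 - fps_X ^ (10 * Suc k))\<^sup>2)) (2 * N + 1)"
    using eventually_conj[OF eta_coeff_limit eventually_ge_at_top]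
    by (blast dest: eventually_happens'[OF sequentially_bot])
  hence "of_int (eta_coeff (2 * N + 1)) = fps_nth (fps_X * (\<Prod>k<n. g k)) (2 * N + 1)"
    unfolding g_def fps_nth_of_int_prod by simp
  also have "\<dots> = fps_nth ((\<Prod>k<n. h k) oo fps_X\<^sup>2) (2 * N)"
    by (simp add: comp)
  also have "\<dots> = fps_nth (\<Prod>k<n. h k) N"
    by (simp add: fps_nth_compose_X_power)
  also have "\<dots> = fps_nth (class_fps 1 * (class_fps 1 - class_fps 0)) N"
    using class_fps_product_agree[OF n] by (simp add: fps_agree_def h_def)
  finally show ?thesis .
qed

section \<open>Comparison of coefficients\<close>

lemma tri_fps_compose: "gen_fps (\<lambda>k. 5 * tri k) (\<lambda>_. 1) = tri_fps oo fps_X ^ 5"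
proof (rule fps_ext)
  fix n
  have "{k. 5 * tri k = n} = (if 5 dvd n then {k. tri k = n div 5} else {})"
    by auto
  thus "fps_nth (gen_fps (\<lambda>k. 5 * tri k) (\<lambda>_. 1)) n = fps_nth (tri_fps oo fps_X ^ 5) n"
    by (simp add: fps_nth_compose_X_power gen_fps_def)
qed

lemma of_nat_tri_reps:
  "of_nat (tri_reps 1 1 5 5 n) =
     fps_nth (tri_fps\<^sup>2 * (gen_fps (\<lambda>k. 5 * tri k) (\<lambda>_. 1))\<^sup>2) n"
proof -
  define A where "A = {(x, y, z, w). int n = int 1 * (x * (x - 1) div 2) + int 1 * (y * (y - 1) div 2)
           + int 5 * (z * (z - 1) div 2) + int 5 * (w * (w - 1) div 2)}"
  define B where "B = {((x, y), (z, w)). tri x + tri y + (5 * tri z + 5 * tri w) = n}"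
  have A: "A = {(x, y, z, w). tri x + tri y + (5 * tri z + 5 * tri w) = n}"
    unfolding A_def int_tri [symmetric] by (auto simp flip: of_nat_add of_nat_mult)
  have "bij_betw (\<lambda>(x, y, z, w). ((x, y), (z, w))) A B"
    by (rule bij_betwI[where g = "\<lambda>((x, y), (z, w)). (x, y, z, w)"]) (auto simp: A B_def)
  hence "tri_reps 1 1 5 5 n = card B"
    unfolding tri_reps_def A_def by (rule bij_betw_same_card)
  moreover have f5: "finite_fibres (\<lambda>k. 5 * tri k)"
    using finite_fibres_theta[of 0 5] by simp
  have "fps_nth (tri_fps\<^sup>2 * (gen_fps (\<lambda>k. 5 * tri k) (\<lambda>_. 1))\<^sup>2) n = of_nat (card B)"
    unfolding power2_eq_square gen_fps_mult[OF finite_fibres_tri finite_fibres_tri]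
      gen_fps_mult[OF f5 f5]
      gen_fps_mult[OF finite_fibres_add[OF finite_fibres_tri finite_fibres_tri] finite_fibres_add[OF f5 f5]]
    by (simp add: gen_fps_def B_def case_prod_unfold)
  ultimately show ?thesis by simp
qed

text \<open>This compares the coefficients of \<open>q^(n+1)\<close> in
  \<open>P^2 - 6 P Q + 5 Q^2 = 16 N (N - Q)\<close>. As \<open>Q^2 = q^2 psi(q^5)^4\<close>,
  Legendre's formula is read there at index \<open>n - 1\<close>, giving
  \<open>5 * 16 = 80\<close>.\<close>

lemma tri_reps_divisor_sum_eta_coeff:
  assumes "n > 0"
  shows "16 * int (divisor_sum (2 * n + 3)) - 6 * int (tri_reps 1 1 5 5 n)
      + 80 * int (if 5 dvd n - 1 then divisor_sum (2 * ((n - 1) div 5) + 1) else 0) =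
    16 * eta_coeff (2 * n + 3)"
proof -
  define T5 :: "complex fps" where "T5 = gen_fps (\<lambda>k. 5 * tri k) (\<lambda>_. 1)"
  define s where "s = (if 5 dvd n - 1 then divisor_sum (2 * ((n - 1) div 5) + 1) else 0)"
  obtain m where m: "n = Suc m" using assms by (cases n) auto
  have "T5 ^ 4 = tri_fps ^ 4 oo fps_X ^ 5"
    unfolding T5_def tri_fps_compose by (rule fps_compose_power) simp
  hence T5: "fps_nth (T5 ^ 4) m = 16 * of_nat s"
    by (simp add: tri_fps_power4 fps_nth_compose_X_power s_def m)
  have L0: "class_fps 0 = fps_X * T5\<^sup>2"
    unfolding T5_def by (rule class_fps_0)
  have "tri_fps ^ 4 - fps_const 6 * (fps_X * (tri_fps\<^sup>2 * T5\<^sup>2)) + fps_const 5 * (fps_X * (fps_X * T5 ^ 4)) =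
      (tri_fps\<^sup>2)\<^sup>2 - 6 * tri_fps\<^sup>2 * class_fps 0 + 5 * (class_fps 0)\<^sup>2"
    unfolding L0 numeral_fps_const [symmetric] by algebra
  also have "\<dots> = 16 * (class_fps 1 * (class_fps 1 - class_fps 0))"
    unfolding tri_fps_square by algebra
  finally have "fps_nth (tri_fps ^ 4) (Suc n) - 6 * fps_nth (tri_fps\<^sup>2 * T5\<^sup>2) n + 5 * fps_nth (T5 ^ 4) m =
      16 * fps_nth (class_fps 1 * (class_fps 1 - class_fps 0)) (Suc n)"
    unfolding numeral_fps_const[of "num.Bit0 _"] fps_eq_iff
    by (auto simp: m dest!: spec[of _ "Suc n"])
  moreover have idx: "2 * Suc n + 1 = 2 * n + 3" by simp
  have psi4: "fps_nth (tri_fps ^ 4) (Suc n) = 16 * of_nat (divisor_sum (2 * n + 3))"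
    unfolding tri_fps_power4 fps_nth_Abs_fps idx ..
  have eta: "fps_nth (class_fps 1 * (class_fps 1 - class_fps 0)) (Suc n) = of_int (eta_coeff (2 * n + 3))"
    unfolding eta_coeff_class_fps [symmetric] idx ..
  ultimately have "complex_of_int (16 * int (divisor_sum (2 * n + 3)) - 6 * int (tri_reps 1 1 5 5 n) + 80 * int s) =
      of_int (16 * eta_coeff (2 * n + 3))"
    unfolding T5 psi4 eta of_nat_tri_reps[of n, folded T5_def, symmetric] by simp
  thus ?thesis
    unfolding of_int_eq_iff s_def .
qed

text \<open>A subtraction-free form for natural numbers. Divisors of \<open>5^(b+1) m\<close> that
  are multiples of 5 are 5 times the divisors of \<open>5^b m\<close>; the others are the divisors
  of \<open>m\<close>.\<close>

lemma divisor_sum_5_power_mult: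
  assumes "\<not> 5 dvd m" "m > 0"
  shows "4 * divisor_sum (5 ^ b * m) + divisor_sum m = 5 ^ (b + 1) * divisor_sum m"
proof (induction b)
  case (Suc b)
  define D where "D = {d. d dvd 5 ^ Suc b * m}"
  have fin: "finite D" unfolding D_def using assms by (intro finite_divisors_nat) auto
  have "{d \<in> D. 5 dvd d} = (*) 5 ` {e. e dvd 5 ^ b * m}"
    by (auto simp: D_def mult.assoc elim!: dvdE)
  hence "\<Sum>{d \<in> D. 5 dvd d} = 5 * divisor_sum (5 ^ b * m)"
    by (simp add: sum.reindex inj_on_def divisor_sum_def sum_distrib_left)
  moreover have "{d \<in> D. \<not> 5 dvd d} = {d. d dvd m}"
  proof (intro equalityI subsetI)
    fix d assume "d \<in> {d \<in> D. \<not> 5 dvd d}"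
    hence d: "d dvd 5 ^ Suc b * m" "\<not> 5 dvd d" by (auto simp: D_def)
    have "prime (5 :: nat)" by simp
    hence "coprime d (5 ^ Suc b)"
      using d(2) prime_imp_coprime[of 5 d] by (simp add: coprime_commute del: power_Suc)
    thus "d \<in> {d. d dvd m}" using d(1) by (simp add: coprime_dvd_mult_right_iff del: power_Suc)
  qed (use assms in \<open>auto simp: D_def dest: dvd_trans\<close>)
  hence "\<Sum>{d \<in> D. \<not> 5 dvd d} = divisor_sum m"
    by (simp add: divisor_sum_def)
  moreover have "\<Sum>D = \<Sum>{d \<in> D. 5 dvd d} + \<Sum>{d \<in> D. \<not> 5 dvd d}"
    using fin by (subst sum.union_disjoint [symmetric]) (auto intro: sum.cong)
  ultimately have "divisor_sum (5 ^ Suc b * m) = 5 * divisor_sum (5 ^ b * m) + divisor_sum m"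
    by (simp add: D_def divisor_sum_def)
  thus ?case using Suc by simp
qed simp

theorem theorem4p2:
  fixes n \<beta> n\<^sub>1 :: nat
  assumes "n > 0"
    and "2 * n + 3 = 5 ^ \<beta> * n\<^sub>1"
    and "n\<^sub>1 > 0"
    and "\<not> 5 dvd n\<^sub>1"
  shows "real (tri_reps 1 1 5 5 n) =
    4 / 3 * (5 ^ (\<beta> + 1) - 3) * real (divisor_sum n\<^sub>1) - 8 / 3 * real_of_int (eta_coeff (2 * n + 3))"
proof -
  define s where "s = (if 5 dvd n - 1 then divisor_sum (2 * ((n - 1) div 5) + 1) else 0)"
  define \<sigma> where "\<sigma> = real (divisor_sum n\<^sub>1)"
  have sigma: "4 * real (divisor_sum (5 ^ b * n\<^sub>1)) = (5 ^ (b + 1) - 1) * \<sigma>" for b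
  proof -
    have "real (4 * divisor_sum (5 ^ b * n\<^sub>1) + divisor_sum n\<^sub>1) = real (5 ^ (b + 1) * divisor_sum n\<^sub>1)"
      unfolding divisor_sum_5_power_mult[OF assms(4,3)] ..
    thus ?thesis by (simp add: \<sigma>_def algebra_simps)
  qed
  \<comment> \<open>From \<open>2n + 3 = 2(n - 1) + 5\<close>, \<open>s\<close> is the divisor sum
    of \<open>(2n + 3)/5\<close> if 5 divides \<open>2n + 3\<close>. Otherwise it is 0, matching
    \<open>5^0 - 1\<close>.\<close>
  have s: "4 * real s = (5 ^ \<beta> - 1) * \<sigma>"
  proof (cases \<beta>)
    case 0
    hence "\<not> 5 dvd 2 * n + 3" using assms by simp
    hence "\<not> 5 dvd n - 1" using \<open>n > 0\<close> by presburger
    thus ?thesis by (simp add: s_def 0)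
  next
    case (Suc b)
    define K where "K = 5 ^ b * n\<^sub>1"
    have "2 * n + 3 = 5 * K" using assms(2) by (simp add: Suc K_def)
    hence "5 dvd n - 1 \<and> 2 * ((n - 1) div 5) + 1 = K" using \<open>n > 0\<close> by presburger
    thus ?thesis using sigma[of b] by (simp add: s_def Suc K_def)
  qed
  have "real_of_int (16 * int (divisor_sum (2 * n + 3)) - 6 * int (tri_reps 1 1 5 5 n) + 80 * int s) =
      real_of_int (16 * eta_coeff (2 * n + 3))"
    unfolding s_def tri_reps_divisor_sum_eta_coeff[OF \<open>n > 0\<close>] ..
  hence "16 * real (divisor_sum (2 * n + 3)) - 6 * real (tri_reps 1 1 5 5 n) + 80 * real s =
      16 * real_of_int (eta_coeff (2 * n + 3))"
    by simp
  \<comment> \<open>The divisor sums combine to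
    \<open>4(5^(b+1) - 1) + 20(5^b - 1) = 8(5^(b+1) - 3)\<close> times \<open>divisor_sum\<close> of
    the part prime to 5, with \<open>b\<close> the exponent of 5; dividing by 6 gives
    \<open>4/3\<close>.\<close>
  thus ?thesis
    using s sigma[of \<beta>] unfolding assms(2) [symmetric] \<sigma>_def [symmetric]
    by (simp add: field_simps)
qed

end
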